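(* Let $(X,\rho)$ be a compact metric space and $\nu$ a non-atomic Borel probability measure on $X$ such that every ball has positive $\nu$-measure. Let $\tau:X\to X$ be a $\nu$-preserving transformation with $\nu(D_\tau)=1$, where $D_\tau$ is the set of all points of continuity of $\tau$. Then there exist a sequence of finite sets $Y_n\subseteq X$ and a sequence of permutations $T_n:Y_n\to Y_n$ such that the sequence of finite dynamical systems $(Y_n,T_n)$ approximates the dynamical system $(X,\nu,\tau)$. Moreover, one can choose the permutations $T_n$ to be transitive.
   Context: We work in an $\aleph_1$-saturated nonstandard universe. For a finite nonempty $Z\subseteq X$ let $\delta_Z=\frac1{|Z|}\sum_{z\in Z}\delta_z$ ($\delta_z$ the Dirac measure at $z$). A sequence of finite sets $Y_n\subseteq X$ approximates the measure space $(X,\nu)$ if $\delta_{Y_n}\to\nu$ in the weak-$*$ topology on Borel measures on $X$. The sequence $(Y_n,T_n)$ (with uniform probability measures on the $Y_n$) approximates the dynamical system $(X,\nu,\tau)$ if $Y_n$ approximates $(X,\nu)$ and, for every infinite $N\in{}^*\mathbb{N}$, the internal permutation $T_N:Y_N\to Y_N$ (the $N$-th term of the nonstandard extension of the sequence) is a hyperfinite approximation of $\tau$. The latter means that $\mathrm{st}\upharpoonright Y_N:Y_N\to X$ is measure preserving from $(Y_N,\mu_L)$ to $(X,\nu)$ and $T_N(y)\approx\tau(\mathrm{st}(y))$ for $\mu_L$-almost all $y\in Y_N$, where $\mathrm{st}:{}^*X\to X$ is the standard part map and $\mu_L$ is the Loeb measure on the hyperfinite set $Y_N$ obtained from the normalized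 counting measure $B\mapsto{}^\circ(|B|/|Y_N|)$ on internal subsets. A permutation of a finite set $Z$ is transitive if it is a single cycle of length $|Z|$. *)

theory Defs
  imports "HOL-Probability.Probability" "HOL-Combinatorics.Cycles"
begin

text \<open>
  Every relation on the standard universe is a relation symbol. A relation is a predicate on
  lists, so that one type serves all arities. Variables are named by natural numbers.
\<close>

datatype 's fm =
    Rel "'s list \<Rightarrow> bool" "nat list"
  | Eq nat nat
  | Neg "'s fm"
  | Conj "'s fm" "'s fm"
  | Ex nat "'s fm"

primrec sat :: "(('s list \<Rightarrow> bool) \<Rightarrow> 't list \<Rightarrow> bool) \<Rightarrow> 's fm \<Rightarrow> (nat \<Rightarrow> 't) \<Rightarrow> bool" where
  "sat I (Rel R vs) e \<longleftrightarrow> I R (map e vs)"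
| "sat I (Eq v w) e \<longleftrightarrow> e v = e w"
| "sat I (Neg \<phi>) e \<longleftrightarrow> \<not> sat I \<phi> e"
| "sat I (Conj \<phi> \<psi>) e \<longleftrightarrow> sat I \<phi> e \<and> sat I \<psi> e"
| "sat I (Ex v \<phi>) e \<longleftrightarrow> (\<exists>t. sat I \<phi> (e(v := t)))"

text \<open>
  The standard objects occurring in the development: points of the space, natural and real
  numbers, sets of points and self-maps of the space. Their sum is one set \<open>V\<close> of a superstructure
  over the space and the reals.
\<close>

datatype 'a entity =
    Point 'a
  | Natural nat
  | Real real
  | Subset "'a set"
  | Selfmap "'a \<Rightarrow> 'a"

text \<open>
  The type \<^typ>\<open>'t\<close> is \<open>*V\<close> (all its elements are internal objects), \<open>std s\<close> is \<open>*s\<close>, and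
  \<open>ext R\<close> is \<open>*R\<close> for a relation \<open>R\<close> on \<open>V\<close>. As \<open>V\<close> is a set of the superstructure, quantifiers
  over \<^typ>\<open>'t\<close> are bounded quantifiers of the nonstandard universe, and the transfer principle
  below is the one for bounded formulas. The sets cut out by the
  extension of a standard relation with internal parameters are internal, so \<open>\<aleph>\<^sub>1\<close>-saturation of the
  universe (a countable family of internal sets with the finite intersection property has a
  common element) gives the second assumption.
\<close>

locale nonstandard_universe =
  fixes std :: "'a::metric_space entity \<Rightarrow> 't"
    and ext :: "('a entity list \<Rightarrow> bool) \<Rightarrow> 't list \<Rightarrow> bool"
  assumes transfer: "\<And>\<phi> e. sat (\<lambda>R. R) \<phi> e \<longleftrightarrow> sat ext \<phi> (std \<circ> e)"
    and saturation: "\<And>A :: nat \<Rightarrow> 't set.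
      (\<And>n. \<exists>R ps. A n = {t. ext R (t # ps)}) \<Longrightarrow>
      (\<And>n. (\<Inter>k\<le>n. A k) \<noteq> {}) \<Longrightarrow> (\<Inter>k. A k) \<noteq> {}"
begin

definition star_set :: "'a entity set \<Rightarrow> 't set" where
  "star_set S = {t. ext (\<lambda>xs. \<exists>s\<in>S. xs = [s]) [t]}"

text \<open>The extension of a function is the relation extension of its graph, the value listed first.\<close>

definition star_fun :: "('a entity list \<Rightarrow> 'a entity) \<Rightarrow> 't list \<Rightarrow> 't" where
  "star_fun f ts = (THE t. ext (\<lambda>xs. \<exists>ys. xs = f ys # ys) (t # ts))"

definition infinite_hypernat :: "'t \<Rightarrow> bool" where
  "infinite_hypernat N \<longleftrightarrow> N \<in> star_set (range Natural) \<and>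
     (\<forall>m. ext (\<lambda>xs. \<exists>i j. xs = [Natural i, Natural j] \<and> i < j) [std (Natural m), N])"

definition st_real :: "'t \<Rightarrow> real" where
  "st_real r = (THE x. \<forall>\<epsilon>>0.
     ext (\<lambda>xs. \<exists>a b. xs = [Real a, Real b] \<and> \<bar>a - b\<bar> < \<epsilon>) [r, std (Real x)])"

definition near :: "'t \<Rightarrow> 't \<Rightarrow> bool" where
  "near s t \<longleftrightarrow> (\<forall>\<epsilon>>0. ext (\<lambda>xs. \<exists>a b. xs = [Point a, Point b] \<and> dist a b < \<epsilon>) [s, t])"

definition st :: "'t \<Rightarrow> 'a" where
  "st y = (THE x. near y (std (Point x)))"

text \<open>
  An internal set of points is an element of \<open>star_set (range Subset)\<close>; it is an element of
  \<^typ>\<open>'t\<close>, and \<open>elems\<close> turns it into an actual set of elements of \<open>*X\<close>.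
\<close>

definition elems :: "'t \<Rightarrow> 't set" where
  "elems H = {y. ext (\<lambda>xs. \<exists>a A. xs = [Point a, Subset A] \<and> a \<in> A) [y, H]}"

definition internal_subsets :: "'t \<Rightarrow> 't set" where
  "internal_subsets H = {B \<in> star_set (range Subset). elems B \<subseteq> elems H}"

definition card_ratio :: "'t \<Rightarrow> 't \<Rightarrow> 't" where
  "card_ratio B H = star_fun
     (\<lambda>xs. case xs of [Subset A, Subset Z] \<Rightarrow> Real (real (card A) / real (card Z))) [B, H]"

text \<open>
  The Loeb measure of a hyperfinite set \<open>H\<close>: the completion of the countably additive extension of
  \<open>B \<mapsto> st (|B| / |H|)\<close> from the internal subsets of \<open>H\<close> to the \<open>\<sigma>\<close>-algebra they generate.
\<close>

definition loeb :: "'t \<Rightarrow> 't measure" where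
  "loeb H = completion (extend_measure (elems H) (internal_subsets H) elems
     (\<lambda>B. ennreal (st_real (card_ratio B H))))"

definition star_apply :: "'t \<Rightarrow> 't \<Rightarrow> 't" where
  "star_apply F y = star_fun (\<lambda>xs. case xs of [Selfmap f, Point x] \<Rightarrow> Point (f x)) [F, y]"

definition star_sets :: "(nat \<Rightarrow> 'a set) \<Rightarrow> 't \<Rightarrow> 't" where
  "star_sets Y N = star_fun (\<lambda>xs. case xs of [Natural n] \<Rightarrow> Subset (Y n)) [N]"

definition star_maps :: "(nat \<Rightarrow> 'a \<Rightarrow> 'a) \<Rightarrow> 't \<Rightarrow> 't" where
  "star_maps T N = star_fun (\<lambda>xs. case xs of [Natural n] \<Rightarrow> Selfmap (T n)) [N]"

end

definition measure_preserving :: "'b measure \<Rightarrow> 'c measure \<Rightarrow> ('b \<Rightarrow> 'c) \<Rightarrow> bool" where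
  "measure_preserving M N f \<longleftrightarrow> f \<in> measurable M N \<and>
     (\<forall>A\<in>sets N. emeasure M (f -` A \<inter> space M) = emeasure N A)"

definition non_atomic :: "'b measure \<Rightarrow> bool" where
  "non_atomic M \<longleftrightarrow> (\<forall>A\<in>sets M. 0 < emeasure M A \<longrightarrow>
     (\<exists>B\<in>sets M. B \<subseteq> A \<and> 0 < emeasure M B \<and> emeasure M B < emeasure M A))"

definition delta :: "'a::metric_space set \<Rightarrow> 'a measure" where
  "delta Z = measure_of UNIV (sets borel)
     (\<lambda>A. (\<Sum>z\<in>Z. emeasure (return borel z) A) / of_nat (card Z))"

text \<open>On a compact space, all continuous functions are test functions of the weak-* topology.\<close>

definition approximates_space :: "(nat \<Rightarrow> 'a::metric_space set) \<Rightarrow> 'a measure \<Rightarrow> bool" where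
  "approximates_space Y \<nu> \<longleftrightarrow> (\<forall>f :: 'a \<Rightarrow> real. continuous_on UNIV f \<longrightarrow>
     (\<lambda>n. \<integral>x. f x \<partial>delta (Y n)) \<longlonglongrightarrow> (\<integral>x. f x \<partial>\<nu>))"

context nonstandard_universe
begin

definition hyperfinite_approximation :: "'t \<Rightarrow> 't \<Rightarrow> 'a measure \<Rightarrow> ('a \<Rightarrow> 'a) \<Rightarrow> bool" where
  "hyperfinite_approximation H F \<nu> \<tau> \<longleftrightarrow>
     measure_preserving (loeb H) \<nu> st \<and>
     (AE y in loeb H. near (star_apply F y) (std (Point (\<tau> (st y)))))"

definition approximates_system ::
  "(nat \<Rightarrow> 'a set) \<Rightarrow> (nat \<Rightarrow> 'a \<Rightarrow> 'a) \<Rightarrow> 'a measure \<Rightarrow> ('a \<Rightarrow> 'a) \<Rightarrow> bool" where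
  "approximates_system Y T \<nu> \<tau> \<longleftrightarrow> approximates_space Y \<nu> \<and>
     (\<forall>N. infinite_hypernat N \<longrightarrow>
        hyperfinite_approximation (star_sets Y N) (star_maps T N) \<nu> \<tau>)"

end

definition transitive_perm :: "('a \<Rightarrow> 'a) \<Rightarrow> 'a set \<Rightarrow> bool" where
  "transitive_perm T Z \<longleftrightarrow> (\<exists>cs. cycle cs \<and> set cs = Z \<and> T = cycle_of_list cs)"

end

theory Submission
  imports Defs
begin

text \<open>
  The proof joins a finite construction and a nonstandard criterion.

  The criterion (\<open>hyperfinite_approximation_of_finite\<close>) reads: if finite sets \<open>Y\<^sub>n\<close> converge weakly to
  \<open>\<nu>\<close> and maps \<open>T\<^sub>n\<close> are such that for every \<open>e > 0\<close> the proportion of points \<open>y\<close> of \<open>Y\<^sub>n\<close> with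
  \<open>dist (T\<^sub>n y) (\<tau> y) \<ge> e\<close> tends to \<open>0\<close>, then \<open>T\<^sub>N\<close> is a hyperfinite approximation of \<open>\<tau>\<close> for every
  infinite \<open>N\<close>. For a closed set \<open>C\<close>, the points of \<open>Y\<^sub>N\<close> with standard part in \<open>C\<close> form the
  intersection of the internal neighbourhoods of \<open>C\<close> of radius \<open>1 / k\<close>, and weak convergence squeezes
  their Loeb measures towards \<open>\<nu> C\<close>; so \<open>st\<close> is measure preserving. By assumption \<open>T\<^sub>N y\<close> is infinitely
  close to \<open>*\<tau> y\<close> outside countably many internal sets of Loeb measure zero, and \<open>*\<tau> y\<close> is
  infinitely close to \<open>\<tau> (st y)\<close> whenever \<open>\<tau>\<close> is continuous at \<open>st y\<close>, which holds for almost all \<open>y\<close>.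

  The finite construction (\<open>finite_approximation_sequence\<close>) provides such sets together with cyclic
  permutations, which settles both halves of the theorem at once. Cut \<open>X\<close> into finitely many small
  cells \<open>P\<^sub>i\<close> and choose from each \<open>P\<^sub>i \<inter> \<tau>\<^sup>-\<^sup>1 P\<^sub>j\<close> a number of points proportional to its measure, up to
  rounding; there are enough points because \<open>\<nu>\<close> is non-atomic. A chosen point is regarded as an edge
  from its own cell to the cell of its image. A cyclic order of the points in which each edge ends
  where its successor begins would send every \<open>y\<close> into the cell of \<open>\<tau> y\<close>. The multigraph need be
  neither balanced nor connected, so such an Eulerian circuit need not exist. But since \<open>\<tau>\<close> preserves
  \<open>\<nu>\<close>, the multigraph is balanced up to rounding errors, and therefore splits into a number of trails
  that depends only on the number of cells (\<open>few_trails\<close>). Running through the trails one after the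
  other gives a cycle in which only the last point of a trail may be sent to a wrong cell, a
  negligible proportion when many points are chosen.

  Transfer is organised around the type of a tuple of internal objects, an ultrafilter on tuples of
  standard objects. Statements about internal objects become statements that hold eventually along
  this filter, standard parts become limits along it, and Loeb measures become limits of
  frequencies.
\<close>

section \<open>Trails in directed multigraphs\<close>

text \<open>
  A point \<open>y\<close> is regarded as an edge of a directed multigraph, leading from \<open>src y\<close> to \<open>tgt y\<close>.
\<close>

definition trail :: "('a \<Rightarrow> 'b) \<Rightarrow> ('a \<Rightarrow> 'b) \<Rightarrow> 'a list \<Rightarrow> bool" where
  "trail src tgt t \<longleftrightarrow> t \<noteq> [] \<and> distinct t \<and> successively (\<lambda>y z. tgt y = src z) t"

text \<open>
  Interior vertices of a trail are left as often as they are entered, so only the two ends count.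
\<close>

lemma trail_telescope:
  assumes "trail src tgt t"
  shows "(\<Sum>y\<in>set t. of_bool (src y = v) - of_bool (tgt y = v)) =
    (of_bool (src (hd t) = v) - of_bool (tgt (last t) = v) :: int)"
proof -
  have "t \<noteq> []" "distinct t" "successively (\<lambda>y z. tgt y = src z) t"
    using assms by (auto simp: trail_def)
  then show ?thesis
    by (induction t rule: list_nonempty_induct) (auto simp: successively_Cons)
qed

lemma trail_append:
  assumes "trail src tgt s" "trail src tgt t" "set s \<inter> set t = {}" "tgt (last s) = src (hd t)"
  shows "trail src tgt (s @ t)"
  using assms by (auto simp: trail_def successively_append_iff)

definition trail_partition :: "('a \<Rightarrow> 'b) \<Rightarrow> ('a \<Rightarrow> 'b) \<Rightarrow> 'a set \<Rightarrow> 'a list set \<Rightarrow> bool" where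
  "trail_partition src tgt Y F \<longleftrightarrow> finite F \<and> (\<forall>t\<in>F. trail src tgt t) \<and>
     (\<forall>s\<in>F. \<forall>t\<in>F. s \<noteq> t \<longrightarrow> set s \<inter> set t = {}) \<and> (\<Union>t\<in>F. set t) = Y"

lemma trail_partition_merge:
  assumes F: "trail_partition src tgt Y F" and st: "s \<in> F" "t \<in> F" "s \<noteq> t" "tgt (last s) = src (hd t)"
  shows "trail_partition src tgt Y (insert (s @ t) (F - {s, t}))"
    and "card (insert (s @ t) (F - {s, t})) < card F"
proof -
  have "trail src tgt (s @ t)"
    using F st by (intro trail_append) (auto simp: trail_partition_def)
  moreover have "(\<Union>u\<in>insert (s @ t) (F - {s, t}). set u) = (\<Union>u\<in>F. set u)"
    using st by auto
  ultimately show "trail_partition src tgt Y (insert (s @ t) (F - {s, t}))"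
    using F st unfolding trail_partition_def by (auto; blast)
  have fin: "finite F" using F by (simp add: trail_partition_def)
  have "card {s, t} \<le> card F" using st fin by (intro card_mono) auto
  moreover have "card (F - {s, t}) = card F - 2"
    using st fin by (simp add: card_Diff_subset)
  ultimately show "card (insert (s @ t) (F - {s, t})) < card F"
    using st(3) card_insert_le_m1[of "card F - 1" "F - {s, t}" "s @ t"] by fastforce
qed

text \<open>
  Take a partition into trails with as few members as possible. No trail can be prolonged by another
  one, so at a vertex where some trail ends no other trail starts. Hence either at most one trail
  starts at \<open>v\<close>, or no trail ends there and the number of starts is the excess of outgoing over
  incoming edges. Summing over \<open>v\<close> bounds the number of trails by a quantity that does not grow with
  \<open>Y\<close> as long as the imbalances stay bounded.
\<close>

lemma few_trails:
  assumes "finite Y" "finite V" "src ` Y \<subseteq> V"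
  obtains F where "trail_partition src tgt Y F"
    and "int (card F) \<le> (\<Sum>v\<in>V. 1 + \<bar>int (card {y\<in>Y. src y = v}) - int (card {y\<in>Y. tgt y = v})\<bar>)"
proof -
  have "trail_partition src tgt Y ((\<lambda>y. [y]) ` Y)"
    using assms(1) by (auto simp: trail_partition_def trail_def)
  then obtain F where F: "trail_partition src tgt Y F"
    and least: "\<And>G. trail_partition src tgt Y G \<Longrightarrow> card F \<le> card G"
    using ex_has_least_nat[of "trail_partition src tgt Y" _ card] by blast
  have fin: "finite F" and tr: "\<And>t. t \<in> F \<Longrightarrow> trail src tgt t" and Y: "(\<Union>t\<in>F. set t) = Y"
    and disj: "\<And>s t. s \<in> F \<Longrightarrow> t \<in> F \<Longrightarrow> s \<noteq> t \<Longrightarrow> set s \<inter> set t = {}"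
    using F by (auto simp: trail_partition_def)
  have no_merge: "s = t" if "s \<in> F" "t \<in> F" "tgt (last s) = src (hd t)" for s t
    using trail_partition_merge[OF F that(1,2) _ that(3)] least by (meson leD)
  define S where "S v = {t\<in>F. src (hd t) = v}" for v
  define E where "E v = {t\<in>F. tgt (last t) = v}" for v
  have balance: "int (card {y\<in>Y. src y = v}) - int (card {y\<in>Y. tgt y = v}) = int (card (S v)) - int (card (E v))" for v
  proof -
    have "int (card {y\<in>Y. src y = v}) - int (card {y\<in>Y. tgt y = v})
        = (\<Sum>y\<in>Y. of_bool (src y = v) - of_bool (tgt y = v))"
      using assms(1) by (simp add: sum_subtractf sum_of_bool_eq Int_def)
    also have "\<dots> = (\<Sum>t\<in>F. \<Sum>y\<in>set t. of_bool (src y = v) - of_bool (tgt y = v))"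
      unfolding Y[symmetric] using fin disj by (intro sum.UNION_disjoint) auto
    also have "\<dots> = (\<Sum>t\<in>F. of_bool (src (hd t) = v) - of_bool (tgt (last t) = v))"
      by (intro sum.cong refl trail_telescope tr)
    also have "\<dots> = int (card (S v)) - int (card (E v))"
      using fin by (simp add: sum_subtractf sum_of_bool_eq Int_def S_def E_def)
    finally show ?thesis .
  qed
  have start: "int (card (S v)) \<le> 1 + \<bar>int (card (S v)) - int (card (E v))\<bar>" for v
  proof (cases "E v = {}")
    case False
    then obtain e where "e \<in> F" "tgt (last e) = v" by (auto simp: E_def)
    then have "S v \<subseteq> {e}" using no_merge[of e] unfolding S_def by fastforce
    then have "card (S v) \<le> card {e}" by (intro card_mono) auto
    then show ?thesis by simp
  qed simp
  have "F \<subseteq> (\<Union>v\<in>V. S v)"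
  proof
    fix t assume t: "t \<in> F"
    then have "hd t \<in> Y" using tr[OF t] Y by (auto simp: trail_def)
    then show "t \<in> (\<Union>v\<in>V. S v)" using assms(3) t by (auto simp: S_def)
  qed
  then have "card F \<le> card (\<Union>v\<in>V. S v)"
    using assms(2) fin by (intro card_mono) (auto simp: S_def)
  also have "\<dots> \<le> (\<Sum>v\<in>V. card (S v))" by (rule card_UN_le[OF assms(2)])
  finally have "int (card F) \<le> (\<Sum>v\<in>V. int (card (S v)))"
    by (metis of_nat_mono of_nat_sum)
  also have "\<dots> \<le> (\<Sum>v\<in>V. 1 + \<bar>int (card {y\<in>Y. src y = v}) - int (card {y\<in>Y. tgt y = v})\<bar>)"
    unfolding balance by (intro sum_mono start)
  finally show thesis using that F by blast
qed

lemma cycle_of_list_next: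
  assumes "distinct (p @ y # z # q)"
  shows "cycle_of_list (p @ y # z # q) y = z"
proof -
  let ?cs = "p @ y # z # q"
  have "map (cycle_of_list ?cs) ?cs = rotate1 ?cs"
    using cyclic_rotation[OF assms, of 1] by simp
  then have "cycle_of_list ?cs (?cs ! length p) = rotate1 ?cs ! length p"
    by (metis length_append length_Cons less_add_Suc1 add_Suc_right nth_map)
  also have "\<dots> = z" by (subst nth_rotate1) (auto simp: nth_append)
  finally show ?thesis by simp
qed

text \<open>
  Concatenating the trails of an economical partition gives a cyclic order in which the end of an
  edge can differ from the beginning of its successor only at the last edge of a trail.
\<close>

lemma cyclic_order_few_breaks:
  assumes "finite Y" "finite V" "src ` Y \<subseteq> V"
  obtains cs where "distinct cs" "set cs = Y"
    and "int (card {y\<in>Y. tgt y \<noteq> src (cycle_of_list cs y)})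
      \<le> (\<Sum>v\<in>V. 1 + \<bar>int (card {y\<in>Y. src y = v}) - int (card {y\<in>Y. tgt y = v})\<bar>)"
proof -
  obtain F where F: "trail_partition src tgt Y F"
    and card: "int (card F) \<le> (\<Sum>v\<in>V. 1 + \<bar>int (card {y\<in>Y. src y = v}) - int (card {y\<in>Y. tgt y = v})\<bar>)"
    using few_trails[OF assms] by blast
  have fin: "finite F" and tr: "\<And>t. t \<in> F \<Longrightarrow> trail src tgt t" and Y: "(\<Union>t\<in>F. set t) = Y"
    and disj: "\<And>s t. s \<in> F \<Longrightarrow> t \<in> F \<Longrightarrow> s \<noteq> t \<Longrightarrow> set s \<inter> set t = {}"
    using F by (auto simp: trail_partition_def)
  obtain ts where ts: "set ts = F" "distinct ts" using finite_distinct_list[OF fin] by blast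
  let ?cs = "concat ts"
  have dist: "distinct ?cs"
    using ts tr disj by (intro distinct_concat) (auto simp: trail_def)
  have "{y\<in>Y. tgt y \<noteq> src (cycle_of_list ?cs y)} \<subseteq> last ` F"
  proof clarify
    fix y assume y: "y \<in> Y" "tgt y \<noteq> src (cycle_of_list ?cs y)"
    show "y \<in> last ` F"
    proof (rule ccontr)
      assume n: "y \<notin> last ` F"
      obtain t where t: "t \<in> F" "y \<in> set t" using y(1) Y by blast
      obtain u w where uw: "t = u @ y # w" using split_list[OF t(2)] by blast
      obtain z w' where w: "w = z # w'" using n t(1) uw by (cases w) force+
      have "tgt y = src z" using tr[OF t(1)] by (simp add: trail_def uw w successively_append_iff)
      moreover obtain a b where "ts = a @ t # b" using split_list[of t ts] t(1) ts(1) by blast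
      then have "?cs = (concat a @ u) @ y # z # (w' @ concat b)" by (simp add: uw w)
      then have "cycle_of_list ?cs y = z" using cycle_of_list_next dist by metis
      ultimately show False using y(2) by simp
    qed
  qed
  then have "card {y\<in>Y. tgt y \<noteq> src (cycle_of_list ?cs y)} \<le> card F"
    using fin by (meson card_image_le card_mono finite_imageI le_trans)
  then show thesis using card Y ts dist by (intro that[of ?cs]) auto
qed

section \<open>Finite cyclic models of a measure-preserving map\<close>

lemma non_atomic_singleton:
  fixes \<nu> :: "'a::t1_space measure"
  assumes "non_atomic \<nu>" "sets \<nu> = sets borel"
  shows "emeasure \<nu> {x} = 0"
proof (rule ccontr)
  assume "emeasure \<nu> {x} \<noteq> 0"
  then obtain B where "B \<subseteq> {x}" "0 < emeasure \<nu> B" "emeasure \<nu> B < emeasure \<nu> {x}"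
    using assms by (metis borel_singleton non_atomic_def not_gr_zero sets.empty_sets)
  then show False by (cases "B = {}") (auto dest: subset_singletonD)
qed

text \<open>
  This is where non-atomicity enters: a set of positive measure is infinite, so arbitrarily many
  distinct points can be chosen in it.
\<close>

lemma non_atomic_finite:
  fixes \<nu> :: "'a::t1_space measure"
  assumes "non_atomic \<nu>" "sets \<nu> = sets borel" "finite A"
  shows "emeasure \<nu> A = 0"
proof -
  have "(\<Union>x\<in>A. {x}) \<in> null_sets \<nu>"
    using assms non_atomic_singleton[OF assms(1,2)]
    by (intro null_sets_UN' countable_finite) (auto intro!: null_setsI)
  then show ?thesis by (auto simp: null_sets_def)
qed

text \<open>
  Compactness provides a finite cover by small balls; the first ball containing a point is its cell.
\<close>

lemma small_cells:
  assumes "compact (UNIV :: 'a::metric_space set)" "0 < \<epsilon>"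
  obtains cell :: "'a::metric_space \<Rightarrow> nat" and m where "cell \<in> measurable borel (count_space UNIV)"
    "\<And>x. cell x < m" "\<And>x y. cell x = cell y \<Longrightarrow> dist x y < \<epsilon>"
proof -
  obtain k :: "'a set" where k: "finite k" "UNIV \<subseteq> (\<Union>x\<in>k. ball x (\<epsilon> / 2))"
    using assms unfolding compact_eq_totally_bounded by (meson half_gt_zero)
  obtain xs where xs: "set xs = k" using finite_list[OF k(1)] by blast
  define P where "P i x \<longleftrightarrow> i < length xs \<and> x \<in> ball (xs ! i) (\<epsilon> / 2)" for i x
  define cell where "cell x = (LEAST i. P i x)" for x
  have "\<exists>i. P i x" for x
    using k(2) xs unfolding P_def by (metis UNIV_I UN_E in_set_conv_nth subset_iff)
  then have cell: "P (cell x) x" for x unfolding cell_def by (metis LeastI)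
  show thesis
  proof
    show "cell \<in> measurable borel (count_space UNIV)"
    proof -
      have "{x. P i x} = (if i < length xs then ball (xs ! i) (\<epsilon> / 2) else {})" for i
        by (auto simp: P_def)
      then have "Measurable.pred borel (P i)" for i
        by (simp add: pred_def)
      then show ?thesis unfolding cell_def by (rule measurable_Least)
    qed
    show "cell x < length xs" for x using cell by (simp add: P_def)
    show "dist x y < \<epsilon>" if "cell x = cell y" for x y
      using cell[of x] cell[of y] that dist_triangle_half_r[of "xs ! cell x" x \<epsilon> y] by (simp add: P_def)
  qed
qed

text \<open>
  The numbers \<open>\<nu> (P\<^sub>i \<inter> \<tau>\<^sup>-\<^sup>1 P\<^sub>j)\<close>, for cells \<open>P\<^sub>i\<close>, form a matrix whose \<open>i\<close>-th row and column
  both sum to \<open>\<nu> P\<^sub>i\<close>, because \<open>\<tau>\<close> preserves \<open>\<nu>\<close>. Scale it by a large \<open>M\<close>, round down, and choose that many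
  points in each \<open>P\<^sub>i \<inter> \<tau>\<^sup>-\<^sup>1 P\<^sub>j\<close>. A chosen point is an edge from its cell to the cell of its image.
  Rounding unbalances every vertex by at most twice the number of cells, so the points can be
  cyclically ordered with a number of breaks that is bounded independently of \<open>M\<close>.
\<close>

lemma finite_cyclic_model:
  fixes \<nu> :: "'a::metric_space measure" and cell :: "'a \<Rightarrow> nat" and \<epsilon> :: real
  assumes prob: "prob_space \<nu>" and sets: "sets \<nu> = sets borel" and na: "non_atomic \<nu>"
    and pres: "measure_preserving \<nu> \<nu> \<tau>"
    and cell: "cell \<in> measurable borel (count_space UNIV)" and bound: "\<And>x. cell x < m"
    and "0 < \<epsilon>"
  obtains cs where "distinct cs" "cs \<noteq> []"
    and "real (card {y\<in>set cs. cell (\<tau> y) \<noteq> cell (cycle_of_list cs y)}) \<le> \<epsilon> * card (set cs)"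
    and "(\<Sum>i<m. \<bar>real (card {y\<in>set cs. cell y = i}) / card (set cs) - measure \<nu> {x. cell x = i}\<bar>) \<le> \<epsilon>"
proof -
  interpret prob_space \<nu> by fact
  have space: "space \<nu> = UNIV" using sets_eq_imp_space_eq[OF sets] by simp
  have tau: "\<tau> \<in> measurable \<nu> \<nu>" using pres by (simp add: measure_preserving_def)
  have cell': "cell \<in> measurable \<nu> (count_space UNIV)"
    using cell measurable_cong_sets[OF sets refl] by blast
  have cell_sets: "{x. cell x = i} \<in> sets \<nu>" for i
    using measurable_sets[OF cell', of "{i}"] by (simp add: space vimage_def)
  have tau_sets: "{x. cell (\<tau> x) = j} \<in> sets \<nu>" for j
    using measurable_sets[OF tau cell_sets[of j]] by (simp add: space vimage_def)
  define A where "A i j = {x. cell x = i \<and> cell (\<tau> x) = j}" for i j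
  define c where "c i j = measure \<nu> (A i j)" for i j
  define p where "p i = measure \<nu> {x. cell x = i}" for i
  have A_sets: "A i j \<in> sets \<nu>" for i j
    using sets.Int[OF cell_sets[of i] tau_sets[of j]] by (simp add: A_def Int_def)
  have row: "(\<Sum>j<m. c i j) = p i" for i
  proof -
    have "{x. cell x = i} = (\<Union>j<m. A i j)" using bound by (auto simp: A_def)
    then show ?thesis unfolding p_def c_def
      by (simp only:) (rule finite_measure_finite_Union[symmetric], use A_sets in \<open>auto simp: disjoint_family_on_def A_def\<close>)
  qed
  have col: "(\<Sum>i<m. c i j) = p j" for j
  proof -
    have "{x. cell (\<tau> x) = j} = (\<Union>i<m. A i j)" using bound by (auto simp: A_def)
    then have "measure \<nu> {x. cell (\<tau> x) = j} = (\<Sum>i<m. c i j)" unfolding c_def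
      by (simp only:) (rule finite_measure_finite_Union, use A_sets in \<open>auto simp: disjoint_family_on_def A_def\<close>)
    moreover have "emeasure \<nu> (\<tau> -` {x. cell x = j} \<inter> space \<nu>) = emeasure \<nu> {x. cell x = j}"
      using pres cell_sets[of j] unfolding measure_preserving_def by blast
    ultimately show ?thesis by (simp add: p_def measure_def space vimage_def)
  qed
  have total: "(\<Sum>i<m. p i) = 1"
  proof -
    have "measure \<nu> (\<Union>i<m. {x. cell x = i}) = (\<Sum>i<m. p i)" unfolding p_def
      by (rule finite_measure_finite_Union) (use cell_sets in \<open>auto simp: disjoint_family_on_def\<close>)
    moreover have "(\<Union>i<m. {x. cell x = i}) = UNIV" using bound by auto
    ultimately show ?thesis using prob_space by (simp add: space)
  qed
  \<comment> \<open>\<open>K\<close> will bound the number of breaks as well as \<open>card Y\<close> times the total error of the cell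
    frequencies; \<open>M\<close> is so large that \<open>K \<le> \<epsilon> * card Y\<close>, given that rounding loses at most \<open>m\<^sup>2\<close> points.\<close>
  define K where "K = real m + 2 * real m * real m"
  obtain M :: nat where M: "real m * real m + 1 + K / \<epsilon> \<le> real M" using real_arch_simple by blast
  define k where "k i j = nat \<lfloor>real M * c i j\<rfloor>" for i j
  have k: "\<bar>real (k i j) - real M * c i j\<bar> \<le> 1" for i j
  proof -
    have "0 \<le> real M * c i j" by (simp add: c_def)
    then show ?thesis unfolding k_def by linarith
  qed
  have "\<exists>Z. finite Z \<and> card Z = k i j \<and> Z \<subseteq> A i j" for i j
  proof (cases "k i j = 0")
    case False
    then have "c i j \<noteq> 0" by (auto simp: k_def)
    then have "infinite (A i j)" using non_atomic_finite[OF na sets] by (auto simp: c_def measure_def)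
    then show ?thesis by (rule infinite_arbitrarily_large)
  qed auto
  then obtain Z where Z: "\<And>i j. finite (Z i j)" "\<And>i j. card (Z i j) = k i j" "\<And>i j. Z i j \<subseteq> A i j"
    by metis
  define Y where "Y = (\<Union>i<m. \<Union>j<m. Z i j)"
  have "finite Y" unfolding Y_def using Z(1) by auto
  have Zmem: "cell x = i" "cell (\<tau> x) = j" if "x \<in> Z i j" for x i j using that Z(3) by (auto simp: A_def)
  have rowY: "card {y\<in>Y. cell y = i} = (\<Sum>j<m. k i j)" if "i < m" for i
  proof -
    have "{y\<in>Y. cell y = i} = (\<Union>j<m. Z i j)" using that by (auto simp: Y_def dest: Zmem)
    then show ?thesis unfolding Z(2)[symmetric]
      by (simp only:) (rule card_UN_disjoint, use Z(1) in \<open>auto dest: Zmem\<close>)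
  qed
  have colY: "card {y\<in>Y. cell (\<tau> y) = j} = (\<Sum>i<m. k i j)" if "j < m" for j
  proof -
    have "{y\<in>Y. cell (\<tau> y) = j} = (\<Union>i<m. Z i j)" using that by (auto simp: Y_def dest: Zmem)
    then show ?thesis unfolding Z(2)[symmetric]
      by (simp only:) (rule card_UN_disjoint, use Z(1) in \<open>auto dest: Zmem\<close>)
  qed
  have approx: "\<bar>real (\<Sum>j<m. k (f j) (g j)) - real M * (\<Sum>j<m. c (f j) (g j))\<bar> \<le> m" for f g
  proof -
    have "\<bar>\<Sum>j<m. real (k (f j) (g j)) - real M * c (f j) (g j)\<bar> \<le> (\<Sum>j<m. 1)"
      by (rule order_trans[OF sum_abs sum_mono[OF k]])
    then show ?thesis by (simp add: sum_subtractf sum_distrib_left)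
  qed
  have row_approx: "\<bar>real (card {y\<in>Y. cell y = i}) - real M * p i\<bar> \<le> m" if "i < m" for i
    using approx[of "\<lambda>_. i" "\<lambda>j. j"] by (simp add: rowY[OF that] row)
  have col_approx: "\<bar>real (card {y\<in>Y. cell (\<tau> y) = j}) - real M * p j\<bar> \<le> m" if "j < m" for j
    using approx[of "\<lambda>i. i" "\<lambda>_. j"] by (simp add: colY[OF that] col)
  define q where "q = real (card Y)"
  have "q = (\<Sum>i<m. real (card {y\<in>Y. cell y = i}))"
  proof -
    have "Y = (\<Union>i<m. {y\<in>Y. cell y = i})" using bound by auto
    then have "card Y = card (\<Union>i<m. {y\<in>Y. cell y = i})" by simp
    also have "\<dots> = (\<Sum>i<m. card {y\<in>Y. cell y = i})"
      using \<open>finite Y\<close> by (intro card_UN_disjoint) auto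
    finally show ?thesis by (simp add: q_def)
  qed
  moreover have "\<bar>\<Sum>i<m. real (card {y\<in>Y. cell y = i}) - real M * p i\<bar> \<le> (\<Sum>i<m. real m)"
    by (rule order_trans[OF sum_abs sum_mono]) (use row_approx in auto)
  ultimately have q: "\<bar>q - real M\<bar> \<le> real m * real m"
    using total by (simp add: sum_subtractf flip: sum_distrib_left)
  have "K \<ge> 0" by (simp add: K_def)
  then have "K / \<epsilon> \<ge> 0" using \<open>0 < \<epsilon>\<close> by simp
  then have "0 < q" and qK: "K / \<epsilon> \<le> q" using q M by linarith+
  then have Kq: "K \<le> \<epsilon> * q" using \<open>0 < \<epsilon>\<close> by (simp add: divide_le_eq mult.commute)
  obtain cs where cs: "distinct cs" "set cs = Y"
    and breaks: "int (card {y\<in>Y. cell (\<tau> y) \<noteq> cell (cycle_of_list cs y)})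
      \<le> (\<Sum>v<m. 1 + \<bar>int (card {y\<in>Y. cell y = v}) - int (card {y\<in>Y. cell (\<tau> y) = v})\<bar>)"
  proof -
    have "cell ` Y \<subseteq> {..<m}" using bound by auto
    from cyclic_order_few_breaks[OF \<open>finite Y\<close> finite_lessThan this, of "\<lambda>y. cell (\<tau> y)"] that
    show thesis by blast
  qed
  show thesis
  proof (rule that[OF cs(1)])
    show "cs \<noteq> []" using cs(2) \<open>0 < q\<close> by (auto simp: q_def)
    have "real (card {y\<in>Y. cell (\<tau> y) \<noteq> cell (cycle_of_list cs y)})
      \<le> (\<Sum>v<m. 1 + \<bar>real (card {y\<in>Y. cell y = v}) - real (card {y\<in>Y. cell (\<tau> y) = v})\<bar>)"
    proof -
      have "real_of_int (int (card {y\<in>Y. cell (\<tau> y) \<noteq> cell (cycle_of_list cs y)}))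
        \<le> real_of_int (\<Sum>v<m. 1 + \<bar>int (card {y\<in>Y. cell y = v}) - int (card {y\<in>Y. cell (\<tau> y) = v})\<bar>)"
        using breaks by (simp only: of_int_le_iff)
      then show ?thesis by simp
    qed
    also have "\<dots> \<le> (\<Sum>v<m. 1 + 2 * real m)"
    proof (rule sum_mono)
      fix v assume "v \<in> {..<m}"
      then show "1 + \<bar>real (card {y\<in>Y. cell y = v}) - real (card {y\<in>Y. cell (\<tau> y) = v})\<bar> \<le> 1 + 2 * real m"
        using row_approx[of v] col_approx[of v] by simp
    qed
    also have "\<dots> = K" by (simp add: K_def algebra_simps)
    finally show "real (card {y\<in>set cs. cell (\<tau> y) \<noteq> cell (cycle_of_list cs y)}) \<le> \<epsilon> * card (set cs)"
      using Kq by (simp add: cs(2) q_def)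
    have "(\<Sum>i<m. \<bar>real (card {y\<in>Y. cell y = i}) / q - p i\<bar>) \<le> (\<Sum>i<m. (real m + real m * real m * p i) / q)"
    proof (rule sum_mono)
      fix i assume "i \<in> {..<m}"
      then have r: "\<bar>real (card {y\<in>Y. cell y = i}) - real M * p i\<bar> \<le> m" using row_approx by simp
      have pi: "0 \<le> p i" by (simp add: p_def)
      have "\<bar>(real M - q) * p i\<bar> \<le> real m * real m * p i"
        using q pi by (simp add: abs_mult abs_minus_commute mult_right_mono)
      then have "\<bar>real (card {y\<in>Y. cell y = i}) - q * p i\<bar> \<le> real m + real m * real m * p i"
        using r by (simp add: algebra_simps)
      then have "\<bar>real (card {y\<in>Y. cell y = i}) - q * p i\<bar> / q \<le> (real m + real m * real m * p i) / q"
        using \<open>0 < q\<close> by (simp add: divide_right_mono)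
      moreover have "real (card {y\<in>Y. cell y = i}) / q - p i = (real (card {y\<in>Y. cell y = i}) - q * p i) / q"
        using \<open>0 < q\<close> by (simp add: diff_divide_distrib)
      then have "\<bar>real (card {y\<in>Y. cell y = i}) / q - p i\<bar> = \<bar>real (card {y\<in>Y. cell y = i}) - q * p i\<bar> / q"
        using \<open>0 < q\<close> by (simp only: abs_divide abs_of_pos)
      ultimately show "\<bar>real (card {y\<in>Y. cell y = i}) / q - p i\<bar> \<le> (real m + real m * real m * p i) / q"
        by simp
    qed
    also have "\<dots> = (real m * real m + real m * real m * (\<Sum>i<m. p i)) / q"
      by (simp add: sum.distrib flip: sum_divide_distrib sum_distrib_left)
    also have "\<dots> \<le> K / q" using \<open>0 < q\<close> by (simp add: total K_def divide_right_mono)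
    also have "\<dots> \<le> \<epsilon>" using Kq \<open>0 < q\<close> by (simp add: divide_le_eq)
    finally show "(\<Sum>i<m. \<bar>real (card {y\<in>set cs. cell y = i}) / card (set cs) - measure \<nu> {x. cell x = i}\<bar>) \<le> \<epsilon>"
      by (simp add: cs(2) q_def p_def)
  qed
qed

text \<open>
  The measure \<open>delta Z\<close> is the image of the uniform distribution on \<open>Z\<close> in the Borel space.
\<close>

lemma integral_delta:
  fixes f :: "'a::metric_space \<Rightarrow> real"
  assumes "finite Z" "Z \<noteq> {}" and f: "continuous_on UNIV f"
  shows "(\<integral>x. f x \<partial>delta Z) = (\<Sum>z\<in>Z. f z) / card Z"
proof -
  let ?P = "distr (measure_pmf (pmf_of_set Z)) borel (\<lambda>x. x)"
  have "delta Z = measure_of UNIV (sets borel) (emeasure ?P)"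
    unfolding delta_def
  proof (rule measure_of_eq)
    show "sets borel \<subseteq> Pow (UNIV :: 'a set)" by simp
    fix A :: "'a set" assume "A \<in> sigma_sets UNIV (sets borel)"
    then have A: "A \<in> sets borel" by (metis sets.sigma_sets_eq space_borel)
    have "(\<Sum>z\<in>Z. emeasure (return borel z) A) = (\<Sum>z\<in>Z. of_nat (of_bool (z \<in> A)))"
      using A by (intro sum.cong) (auto simp: indicator_def)
    also have "\<dots> = of_nat (\<Sum>z\<in>Z. of_bool (z \<in> A))" by simp
    also have "(\<Sum>z\<in>Z. of_bool (z \<in> A)) = card (Z \<inter> A)"
      using assms(1) by (simp add: sum_of_bool_eq)
    finally have "(\<Sum>z\<in>Z. emeasure (return borel z) A) / of_nat (card Z)
      = of_nat (card (Z \<inter> A)) / of_nat (card Z)" by simp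
    also have "\<dots> = ennreal (card (Z \<inter> A) / card Z)"
      using assms(1,2) by (simp add: ennreal_of_nat_eq_real_of_nat divide_ennreal card_gt_0_iff)
    also have "\<dots> = emeasure ?P A"
      using A assms(1,2) by (simp add: emeasure_distr emeasure_pmf_of_set)
    finally show "(\<Sum>z\<in>Z. emeasure (return borel z) A) / of_nat (card Z) = emeasure ?P A" .
  qed
  also have "\<dots> = ?P" using measure_of_of_measure[of ?P] by simp
  finally have "delta Z = ?P" .
  then show ?thesis
    using assms borel_measurable_continuous_onI[OF f]
    by (simp add: integral_distr integral_pmf_of_set)
qed

lemma approximates_space_iff:
  assumes "\<And>n. finite (Y n)" "\<And>n. Y n \<noteq> {}"
  shows "approximates_space Y \<nu> \<longleftrightarrow> (\<forall>f :: 'a::metric_space \<Rightarrow> real. continuous_on UNIV f \<longrightarrow>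
    (\<lambda>n. (\<Sum>y\<in>Y n. f y) / real (card (Y n))) \<longlonglongrightarrow> (\<integral>x. f x \<partial>\<nu>))"
  using assms by (simp add: approximates_space_def integral_delta)

text \<open>
  Both averages change by at most \<open>\<eta>\<close> when \<open>f\<close> is replaced by a function that is constant on cells,
  and for such a function they depend only on the frequencies of the cells.
\<close>

lemma average_close:
  fixes \<nu> :: "'a::metric_space measure" and cell :: "'a \<Rightarrow> nat" and f :: "'a \<Rightarrow> real"
  assumes prob: "prob_space \<nu>" and sets: "sets \<nu> = sets borel"
    and cell: "cell \<in> measurable borel (count_space UNIV)" and bound: "\<And>x. cell x < m"
    and Y: "finite Y" "Y \<noteq> {}"
    and freq: "(\<Sum>i<m. \<bar>real (card {y\<in>Y. cell y = i}) / card Y - measure \<nu> {x. cell x = i}\<bar>) \<le> \<epsilon>"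
    and f: "f \<in> borel_measurable borel" and B: "\<And>x. \<bar>f x\<bar> \<le> B"
    and osc: "\<And>x y. cell x = cell y \<Longrightarrow> \<bar>f x - f y\<bar> \<le> \<eta>"
  shows "\<bar>(\<Sum>y\<in>Y. f y) / card Y - (\<integral>x. f x \<partial>\<nu>)\<bar> \<le> 2 * \<eta> + B * \<epsilon>"
proof -
  interpret prob_space \<nu> by fact
  have space: "space \<nu> = UNIV" using sets_eq_imp_space_eq[OF sets] by simp
  have cell': "cell \<in> measurable \<nu> (count_space UNIV)"
    using cell measurable_cong_sets[OF sets refl] by blast
  have cell_sets: "{x. cell x = i} \<in> sets \<nu>" for i
    using measurable_sets[OF cell', of "{i}"] by (simp add: space vimage_def)
  \<comment> \<open>For an empty cell the value of \<open>g\<close> is an arbitrary value of \<open>f\<close>, which still obeys the bound \<open>B\<close>.\<close>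
  define g where "g i = f (SOME x. cell x = i)" for i
  have gB: "\<bar>g i\<bar> \<le> B" for i using B by (simp add: g_def)
  have gf: "\<bar>f x - g (cell x)\<bar> \<le> \<eta>" for x
    unfolding g_def by (rule osc) (metis (mono_tags) someI)
  have "\<bar>(\<Sum>y\<in>Y. f y) / card Y - (\<Sum>y\<in>Y. g (cell y)) / card Y\<bar> \<le> \<eta>"
  proof -
    have "\<bar>\<Sum>y\<in>Y. f y - g (cell y)\<bar> \<le> (\<Sum>y\<in>Y. \<eta>)"
      by (rule order_trans[OF sum_abs sum_mono[OF gf]])
    then show ?thesis using Y
      by (simp add: sum_subtractf card_gt_0_iff divide_le_eq mult.commute flip: diff_divide_distrib)
  qed
  moreover have "(\<Sum>y\<in>Y. g (cell y)) / card Y = (\<Sum>i<m. g i * card {y\<in>Y. cell y = i}) / card Y"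
  proof -
    have "(\<Sum>y\<in>Y. g (cell y)) = (\<Sum>i<m. \<Sum>y\<in>{y\<in>Y. cell y = i}. g (cell y))"
      using Y bound by (intro sum.group[symmetric]) auto
    then show ?thesis by (simp add: mult.commute)
  qed
  moreover have "(\<integral>x. g (cell x) \<partial>\<nu>) = (\<Sum>i<m. g i * measure \<nu> {x. cell x = i})"
  proof -
    have "g (cell x) = (\<Sum>i<m. g i * indicator {x. cell x = i} x)" for x
      using bound[of x] by (simp add: indicator_def sum.delta if_distrib cong: if_cong)
    then have "(\<integral>x. g (cell x) \<partial>\<nu>) = (\<integral>x. (\<Sum>i<m. g i * indicator {x. cell x = i} x) \<partial>\<nu>)" by simp
    also have "\<dots> = (\<Sum>i<m. (\<integral>x. g i * indicator {x. cell x = i} x \<partial>\<nu>))"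
      using cell_sets by (intro Bochner_Integration.integral_sum) (auto simp: less_top[symmetric])
    finally show ?thesis using cell_sets by (simp add: space)
  qed
  moreover have "\<bar>(\<integral>x. f x \<partial>\<nu>) - (\<integral>x. g (cell x) \<partial>\<nu>)\<bar> \<le> \<eta>"
  proof -
    have fm: "f \<in> borel_measurable \<nu>" using f measurable_cong_sets[OF sets refl] by blast
    have gm: "(\<lambda>x. g (cell x)) \<in> borel_measurable \<nu>"
      by (rule measurable_compose[OF cell']) simp
    have fi: "integrable \<nu> f" by (rule integrable_const_bound[of _ B]) (use B fm in auto)
    have gi: "integrable \<nu> (\<lambda>x. g (cell x))" by (rule integrable_const_bound[of _ B]) (use gB gm in auto)
    have "\<bar>\<integral>x. f x - g (cell x) \<partial>\<nu>\<bar> \<le> (\<integral>x. \<bar>f x - g (cell x)\<bar> \<partial>\<nu>)" by (rule integral_abs_bound)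
    also have "\<dots> \<le> (\<integral>x. \<eta> \<partial>\<nu>)"
      using fi gi gf by (intro integral_mono) auto
    finally show ?thesis using fi gi prob_space by simp
  qed
  moreover have "\<bar>(\<Sum>i<m. g i * card {y\<in>Y. cell y = i}) / card Y - (\<Sum>i<m. g i * measure \<nu> {x. cell x = i})\<bar> \<le> B * \<epsilon>"
  proof -
    have "\<bar>(\<Sum>i<m. g i * card {y\<in>Y. cell y = i}) / card Y - (\<Sum>i<m. g i * measure \<nu> {x. cell x = i})\<bar>
      = \<bar>\<Sum>i<m. g i * (card {y\<in>Y. cell y = i} / card Y - measure \<nu> {x. cell x = i})\<bar>"
      by (simp add: right_diff_distrib sum_subtractf sum_divide_distrib)
    also have "\<dots> \<le> (\<Sum>i<m. B * \<bar>card {y\<in>Y. cell y = i} / card Y - measure \<nu> {x. cell x = i}\<bar>)"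
      by (rule order_trans[OF sum_abs sum_mono]) (simp add: abs_mult gB mult_right_mono)
    also have "\<dots> \<le> B * \<epsilon>"
      using mult_left_mono[OF freq order_trans[OF abs_ge_zero B]] by (simp flip: sum_distrib_left)
    finally show ?thesis .
  qed
  ultimately show ?thesis by linarith
qed

text \<open>
  Cells of diameter \<open>1 / (n + 1)\<close> are used for the \<open>n\<close>-th set. A uniformly continuous function
  oscillates little on them, which gives weak convergence, and two points in the same cell are close,
  which turns an unbroken link of the cycle into an approximate value of \<open>\<tau>\<close>.
\<close>

lemma finite_approximation_sequence:
  fixes \<nu> :: "'a::metric_space measure"
  assumes comp: "compact (UNIV :: 'a set)" and prob: "prob_space \<nu>" and sets: "sets \<nu> = sets borel"
    and na: "non_atomic \<nu>" and pres: "measure_preserving \<nu> \<nu> \<tau>"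
  obtains cs :: "nat \<Rightarrow> 'a list" where "\<And>n. distinct (cs n)" "\<And>n. cs n \<noteq> []"
    "approximates_space (\<lambda>n. set (cs n)) \<nu>"
    "\<And>e. 0 < e \<Longrightarrow> (\<lambda>n. real (card {y\<in>set (cs n). dist (cycle_of_list (cs n) y) (\<tau> y) \<ge> e}) / card (set (cs n))) \<longlonglongrightarrow> 0"
proof -
  define \<epsilon> where "\<epsilon> n = 1 / real (Suc n)" for n
  have \<epsilon>: "0 < \<epsilon> n" for n by (simp add: \<epsilon>_def)
  have \<epsilon>_lim: "\<epsilon> \<longlonglongrightarrow> 0" unfolding \<epsilon>_def by (rule LIMSEQ_Suc[OF lim_const_over_n])
  define good where "good n cell m cs \<longleftrightarrow> cell \<in> measurable borel (count_space UNIV) \<and> (\<forall>x. cell x < m) \<and>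
      (\<forall>x y. cell x = cell y \<longrightarrow> dist x y < \<epsilon> n) \<and> distinct cs \<and> cs \<noteq> [] \<and>
      real (card {y\<in>set cs. cell (\<tau> y) \<noteq> cell (cycle_of_list cs y)}) \<le> \<epsilon> n * card (set cs) \<and>
      (\<Sum>i<m. \<bar>real (card {y\<in>set cs. cell y = i}) / card (set cs) - measure \<nu> {x. cell x = i}\<bar>) \<le> \<epsilon> n"
    for n m :: nat and cell :: "'a \<Rightarrow> nat" and cs
  have "\<exists>cell m cs. good n cell m cs" for n
  proof -
    obtain cell :: "'a \<Rightarrow> nat" and m where cell: "cell \<in> measurable borel (count_space UNIV)"
      "\<And>x. cell x < m" "\<And>x y. cell x = cell y \<Longrightarrow> dist x y < \<epsilon> n"
      using small_cells[OF comp \<epsilon>[of n]] by blast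
    show ?thesis
    proof (rule finite_cyclic_model[OF prob sets na pres cell(1,2) \<epsilon>[of n]])
      fix cs assume "distinct cs" "cs \<noteq> []"
        "real (card {y\<in>set cs. cell (\<tau> y) \<noteq> cell (cycle_of_list cs y)}) \<le> \<epsilon> n * card (set cs)"
        "(\<Sum>i<m. \<bar>real (card {y\<in>set cs. cell y = i}) / card (set cs) - measure \<nu> {x. cell x = i}\<bar>) \<le> \<epsilon> n"
      with cell have "good n cell m cs" unfolding good_def by simp
      then show ?thesis by blast
    qed
  qed
  then obtain cell m cs where "\<And>n. good n (cell n) (m n) (cs n)" by metis
  note P = this[unfolded good_def]
  have avg: "(\<lambda>n. (\<Sum>y\<in>set (cs n). f y) / card (set (cs n))) \<longlonglongrightarrow> (\<integral>x. f x \<partial>\<nu>)"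
    if f: "continuous_on UNIV f" for f :: "'a \<Rightarrow> real"
  proof -
    have fm: "f \<in> borel_measurable borel" by (rule borel_measurable_continuous_onI[OF f])
    have "bounded (range f)" by (rule compact_imp_bounded[OF compact_continuous_image[OF f comp]])
    then obtain B where B: "\<And>x. \<bar>f x\<bar> \<le> B" by (auto simp: bounded_iff)
    have uc: "uniformly_continuous_on UNIV f" by (rule compact_uniformly_continuous[OF f comp])
    show ?thesis
    proof (rule tendstoI)
      fix e :: real assume "0 < e"
      then have e4: "0 < e / 4" by simp
      obtain d where d: "0 < d" "\<And>x y. dist x y < d \<Longrightarrow> dist (f x) (f y) < e / 4"
        using uc e4 unfolding uniformly_continuous_on_def by (metis UNIV_I)
      have "(\<lambda>n. B * \<epsilon> n) \<longlonglongrightarrow> 0" using tendsto_mult_left[OF \<epsilon>_lim, of B] by simp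
      then have "eventually (\<lambda>n. B * \<epsilon> n < e / 2) sequentially"
        using \<open>0 < e\<close> by (intro order_tendstoD) auto
      moreover have "eventually (\<lambda>n. \<epsilon> n < d) sequentially" by (rule order_tendstoD(2)[OF \<epsilon>_lim d(1)])
      ultimately show "eventually (\<lambda>n. dist ((\<Sum>y\<in>set (cs n). f y) / card (set (cs n))) (\<integral>x. f x \<partial>\<nu>) < e) sequentially"
      proof eventually_elim
        case (elim n)
        have "\<bar>f x - f y\<bar> \<le> e / 4" if "cell n x = cell n y" for x y
        proof -
          have "dist x y < d" using P[of n] that elim(2) by (meson less_trans)
          then show ?thesis using d(2)[of x y] by (simp add: dist_real_def)
        qed
        then have "\<bar>(\<Sum>y\<in>set (cs n). f y) / card (set (cs n)) - (\<integral>x. f x \<partial>\<nu>)\<bar> \<le> 2 * (e / 4) + B * \<epsilon> n"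
          using P[of n] by (intro average_close[OF prob sets, of "cell n" "m n"] fm B) auto
        then show ?case using elim(1) by (simp add: dist_real_def)
      qed
    qed
  qed
  show thesis
  proof (rule that[of cs])
    show "distinct (cs n)" "cs n \<noteq> []" for n using P by auto
    show "approximates_space (\<lambda>n. set (cs n)) \<nu>"
      using P avg by (subst approximates_space_iff) auto
  next
    fix e :: real assume e: "0 < e"
    have "eventually (\<lambda>n. \<epsilon> n < e) sequentially" by (rule order_tendstoD(2)[OF \<epsilon>_lim e])
    then have "eventually (\<lambda>n. real (card {y\<in>set (cs n). dist (cycle_of_list (cs n) y) (\<tau> y) \<ge> e}) / card (set (cs n)) \<le> \<epsilon> n) sequentially"
    proof eventually_elim
      case (elim n)
      have "{y\<in>set (cs n). dist (cycle_of_list (cs n) y) (\<tau> y) \<ge> e}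
        \<subseteq> {y\<in>set (cs n). cell n (\<tau> y) \<noteq> cell n (cycle_of_list (cs n) y)}"
        using P[of n] elim by (smt (verit, best) Collect_mono)
      then have "real (card {y\<in>set (cs n). dist (cycle_of_list (cs n) y) (\<tau> y) \<ge> e})
        \<le> card {y\<in>set (cs n). cell n (\<tau> y) \<noteq> cell n (cycle_of_list (cs n) y)}"
        by (intro of_nat_mono card_mono) auto
      also have "\<dots> \<le> \<epsilon> n * card (set (cs n))" using P[of n] by blast
      finally show ?case using P[of n] by (simp add: divide_le_eq card_gt_0_iff)
    qed
    then show "(\<lambda>n. real (card {y\<in>set (cs n). dist (cycle_of_list (cs n) y) (\<tau> y) \<ge> e}) / card (set (cs n))) \<longlonglongrightarrow> 0"
      by (intro tendsto_sandwich[OF _ _ tendsto_const \<epsilon>_lim]) auto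
  qed
qed

section \<open>Transfer and types of internal tuples\<close>

primrec fv :: "'s fm \<Rightarrow> nat set" where
  "fv (Rel R vs) = set vs"
| "fv (Eq v w) = {v, w}"
| "fv (Neg \<phi>) = fv \<phi>"
| "fv (Conj \<phi> \<psi>) = fv \<phi> \<union> fv \<psi>"
| "fv (Ex v \<phi>) = fv \<phi> - {v}"

lemma finite_fv: "finite (fv \<phi>)"
  by (induction \<phi>) auto

lemma sat_cong_fv: "(\<And>v. v \<in> fv \<phi> \<Longrightarrow> e v = e' v) \<Longrightarrow> sat I \<phi> e \<longleftrightarrow> sat I \<phi> e'"
proof (induction \<phi> arbitrary: e e')
  case (Rel R vs)
  then have "map e vs = map e' vs" by simp
  then show ?case by (simp only: sat.simps)
next
  case (Ex v \<phi>)
  have "sat I \<phi> (e(v := t)) \<longleftrightarrow> sat I \<phi> (e'(v := t))" for t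
    using Ex.prems by (intro Ex.IH) auto
  then show ?case by simp
next
  case (Conj \<phi> \<psi>)
  have "sat I \<phi> e \<longleftrightarrow> sat I \<phi> e'" by (rule Conj.IH(1)) (simp add: Conj.prems)
  moreover have "sat I \<psi> e \<longleftrightarrow> sat I \<psi> e'" by (rule Conj.IH(2)) (simp add: Conj.prems)
  ultimately show ?case by simp
next
  case (Neg \<phi>)
  have "sat I \<phi> e \<longleftrightarrow> sat I \<phi> e'" by (rule Neg.IH) (simp add: Neg.prems)
  then show ?case by simp
qed simp

definition Forall :: "nat list \<Rightarrow> 's fm \<Rightarrow> 's fm" where
  "Forall = foldr (\<lambda>v \<phi>. Neg (Ex v (Neg \<phi>)))"

lemma sat_Forall:
  "sat I (Forall vs \<phi>) e \<longleftrightarrow> (\<forall>e'. (\<forall>v. v \<notin> set vs \<longrightarrow> e' v = e v) \<longrightarrow> sat I \<phi> e')"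
proof (induction vs arbitrary: e)
  case Nil
  have "e' = e" if "\<forall>v. e' v = e v" for e' using that by auto
  then show ?case by (auto simp: Forall_def)
next
  case (Cons w vs)
  have "sat I (Forall (w # vs) \<phi>) e \<longleftrightarrow> (\<forall>t. sat I (Forall vs \<phi>) (e(w := t)))"
    by (simp add: Forall_def)
  also have "\<dots> \<longleftrightarrow> (\<forall>t e'. (\<forall>v. v \<notin> set vs \<longrightarrow> e' v = (e(w := t)) v) \<longrightarrow> sat I \<phi> e')"
    by (simp only: Cons.IH)
  also have "\<dots> \<longleftrightarrow> (\<forall>e'. (\<forall>v. v \<notin> set (w # vs) \<longrightarrow> e' v = e v) \<longrightarrow> sat I \<phi> e')"
  proof (intro iffI allI impI)
    fix e' assume *: "\<forall>t e'. (\<forall>v. v \<notin> set vs \<longrightarrow> e' v = (e(w := t)) v) \<longrightarrow> sat I \<phi> e'"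
      and e': "\<forall>v. v \<notin> set (w # vs) \<longrightarrow> e' v = e v"
    show "sat I \<phi> e'" by (rule *[rule_format, of e' "e' w"]) (use e' in simp)
  next
    fix t e' assume *: "\<forall>e'. (\<forall>v. v \<notin> set (w # vs) \<longrightarrow> e' v = e v) \<longrightarrow> sat I \<phi> e'"
      and e': "\<forall>v. v \<notin> set vs \<longrightarrow> e' v = (e(w := t)) v"
    show "sat I \<phi> e'" by (rule *[rule_format]) (use e' in simp)
  qed
  finally show ?case .
qed

context nonstandard_universe
begin

text \<open>
  Transfer speaks about standard parameters only. A formula that holds for all standard parameters
  can be closed by universal quantifiers first, and then holds for all internal ones.
\<close>

lemma transfer_valid:
  assumes "\<And>e. sat (\<lambda>R. R) \<phi> e"
  shows "sat ext \<phi> e"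
proof -
  obtain vs where vs: "set vs = fv \<phi>" using finite_list[OF finite_fv] by blast
  let ?e0 = "\<lambda>_. Natural 0"
  have "sat (\<lambda>R. R) (Forall vs \<phi>) ?e0" using assms by (simp add: sat_Forall)
  then have "sat ext (Forall vs \<phi>) (std \<circ> ?e0)" by (simp only: transfer)
  then have "sat ext \<phi> (\<lambda>v. if v \<in> set vs then e v else (std \<circ> ?e0) v)"
    by (simp add: sat_Forall)
  then show ?thesis by (subst (asm) sat_cong_fv[where e' = e]) (auto simp: vs)
qed

abbreviation valuation :: "'t list \<Rightarrow> nat \<Rightarrow> 't" where
  "valuation ts v \<equiv> (if v < length ts then ts ! v else std (Natural 0))"

lemma map_valuation: "map (valuation ts) [0..<length ts] = ts"
  by (rule nth_equalityI) auto

lemma ext_std: "ext R (map std ps) \<longleftrightarrow> R ps"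
proof -
  let ?e = "\<lambda>v. if v < length ps then ps ! v else Natural 0"
  have "map ?e [0..<length ps] = ps" "map (std \<circ> ?e) [0..<length ps] = map std ps"
    by (rule nth_equalityI; simp)+
  then show ?thesis using transfer[of "Rel R [0..<length ps]" ?e] by simp
qed

lemma ext_mp:
  assumes "\<And>xs. length xs = length ts \<Longrightarrow> P xs \<Longrightarrow> Q xs \<Longrightarrow> R xs" "ext P ts" "ext Q ts"
  shows "ext R ts"
proof -
  let ?v = "[0..<length ts]"
  let ?\<phi> = "Neg (Conj (Conj (Rel P ?v) (Rel Q ?v)) (Neg (Rel R ?v)))"
  have "sat (\<lambda>R. R) ?\<phi> e" for e using assms(1) by auto
  from transfer_valid[OF this, of "valuation ts"] show ?thesis
    using assms by (simp only: sat.simps map_valuation) blast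
qed

lemma ext_True: "ext (\<lambda>_. True) ts"
  using transfer_valid[of "Rel (\<lambda>_. True) [0..<length ts]" "valuation ts"]
  by (simp only: sat.simps map_valuation)

lemma ext_mono: "(\<And>xs. length xs = length ts \<Longrightarrow> P xs \<Longrightarrow> R xs) \<Longrightarrow> ext P ts \<Longrightarrow> ext R ts"
  using ext_mp[of ts P P R] by blast

lemma ext_Not: "ext (\<lambda>xs. \<not> P xs) ts \<longleftrightarrow> \<not> ext P ts"
proof -
  let ?v = "[0..<length ts]"
  let ?A = "Conj (Rel P ?v) (Rel (\<lambda>xs. \<not> P xs) ?v)"
  let ?B = "Conj (Neg (Rel P ?v)) (Neg (Rel (\<lambda>xs. \<not> P xs) ?v))"
  have "sat (\<lambda>R. R) (Conj (Neg ?A) (Neg ?B)) e" for e by auto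
  from transfer_valid[OF this, of "valuation ts"] show ?thesis
    by (simp only: sat.simps map_valuation) blast
qed

text \<open>
  Values of extended functions, and elements witnessing that one internal set is not contained in
  another, are obtained from this rule.
\<close>

lemma ext_Ex: "(\<exists>t. ext P (t # ts)) \<longleftrightarrow> ext (\<lambda>xs. \<exists>x. P (x # xs)) ts"
proof -
  let ?n = "length ts"
  let ?v = "[0..<?n]"
  let ?A = "Ex ?n (Rel P (?n # ?v))"
  let ?B = "Rel (\<lambda>xs. \<exists>x. P (x # xs)) ?v"
  have *: "map (e(?n := t)) ?v = map e ?v" for e and t :: 'u by simp
  have "sat (\<lambda>R. R) (Conj (Neg (Conj ?A (Neg ?B))) (Neg (Conj ?B (Neg ?A)))) e" for e
    by (simp only: sat.simps list.map * fun_upd_same; blast)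
  from transfer_valid[OF this, of "valuation ts"] show ?thesis
    by (simp only: sat.simps map_valuation list.map * fun_upd_same) blast
qed

lemma ext_eq: "ext (\<lambda>xs. xs ! 0 = xs ! 1) [s, t] \<longleftrightarrow> s = t"
proof -
  let ?A = "Rel (\<lambda>xs. xs ! 0 = xs ! 1) [0, 1]"
  let ?B = "Eq 0 1"
  have "sat (\<lambda>R. R) (Conj (Neg (Conj ?A (Neg ?B))) (Neg (Conj ?B (Neg ?A)))) e" for e
    by simp
  from transfer_valid[OF this, of "valuation [s,t]"] show ?thesis by simp blast
qed

lemma ext_reindex:
  assumes "set is \<subseteq> {..<length ts}"
  shows "ext P (map ((!) ts) is) \<longleftrightarrow> ext (\<lambda>xs. P (map ((!) xs) is)) ts"
proof -
  let ?v = "[0..<length ts]"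
  let ?A = "Rel P is"
  let ?B = "Rel (\<lambda>xs. P (map ((!) xs) is)) ?v"
  have "map ((!) (map e ?v)) is = map e is" for e :: "nat \<Rightarrow> 'a entity"
    using assms by auto
  then have "sat (\<lambda>R. R) (Conj (Neg (Conj ?A (Neg ?B))) (Neg (Conj ?B (Neg ?A)))) e" for e
    by (simp only: sat.simps; blast)
  moreover have "map (valuation ts) is = map ((!) ts) is"
    using assms by auto
  ultimately show ?thesis
    using transfer_valid[of "Conj (Neg (Conj ?A (Neg ?B))) (Neg (Conj ?B (Neg ?A)))" "valuation ts"]
    by (simp only: sat.simps map_valuation) blast
qed

text \<open>
  The type of a tuple in the sense of model theory: the standard relations whose extensions the tuple
  satisfies. It is an ultrafilter on tuples of standard objects. In this form transfer becomes
  reasoning about what holds eventually: an internal object behaves like a generic standard one.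
\<close>

definition tp :: "'t list \<Rightarrow> 'a entity list filter" where
  "tp ts = Abs_filter (\<lambda>P. ext P ts)"

lemma eventually_tp: "eventually P (tp ts) \<longleftrightarrow> ext P ts"
  unfolding tp_def
proof (rule eventually_Abs_filter, rule is_filter.intro)
  show "ext (\<lambda>_. True) ts" by (rule ext_True)
  show "ext (\<lambda>xs. P xs \<and> Q xs) ts" if "ext P ts" "ext Q ts" for P Q
    using ext_mp[OF _ that] by simp
  show "ext Q ts" if "\<forall>x. P x \<longrightarrow> Q x" "ext P ts" for P Q
    using ext_mono[OF _ that(2)] that(1) by simp
qed

lemma tp_length: "eventually (\<lambda>xs. length xs = length ts) (tp ts)"
  unfolding eventually_tp by (rule ext_mono[OF _ ext_True])

lemma tp_Not: "eventually (\<lambda>xs. \<not> P xs) (tp ts) \<longleftrightarrow> \<not> eventually P (tp ts)"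
  by (simp add: eventually_tp ext_Not)

lemma tp_neq_bot [simp]: "tp ts \<noteq> bot"
  using tp_Not[of "\<lambda>_. False" ts] by (simp add: trivial_limit_def)

lemma tp_reindex:
  "set is \<subseteq> {..<length ts} \<Longrightarrow> tp (map ((!) ts) is) = filtermap (\<lambda>xs. map ((!) xs) is) (tp ts)"
  by (simp add: filter_eq_iff eventually_filtermap eventually_tp ext_reindex)

lemma tp_append_std: "tp (ts @ map std ps) = filtermap (\<lambda>xs. xs @ ps) (tp ts)"
proof -
  let ?n = "length ts" and ?m = "length ps"
  let ?ts = "ts @ map std ps"
  have 1: "ts = map ((!) ?ts) [0..<?n]"
    by (rule nth_equalityI) (auto simp: nth_append)
  have 2: "map std ps = map ((!) ?ts) [?n..<?n+?m]"
    by (rule nth_equalityI) (auto simp: nth_append)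
  have "ext (\<lambda>xs. xs = ps) (map std ps)" by (simp add: ext_std)
  then have "ext (\<lambda>xs. map ((!) xs) [?n..<?n+?m] = ps) ?ts"
    by (subst (asm) 2, subst (asm) ext_reindex) auto
  then have "eventually (\<lambda>xs. map ((!) xs) [?n..<?n+?m] = ps) (tp ?ts)"
    by (simp add: eventually_tp)
  then have *: "eventually (\<lambda>xs. map ((!) xs) [0..<?n] @ ps = xs) (tp ?ts)"
    using tp_length[of ?ts]
  proof eventually_elim
    case (elim xs)
    have "xs = map ((!) xs) [0..<?n+?m]" using elim by (auto intro: nth_equalityI)
    also have "\<dots> = map ((!) xs) [0..<?n] @ map ((!) xs) [?n..<?n+?m]"
      by (metis map_append upt_add_eq_append zero_le)
    finally show ?case using elim by simp
  qed
  have "eventually P (tp ?ts) \<longleftrightarrow> eventually (\<lambda>xs. P (xs @ ps)) (tp ts)" for P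
  proof -
    have "eventually (\<lambda>xs. P (xs @ ps)) (tp ts)
      \<longleftrightarrow> eventually (\<lambda>xs. P (map ((!) xs) [0..<?n] @ ps)) (tp ?ts)"
      by (subst 1, subst tp_reindex) (auto simp: eventually_filtermap)
    also have "\<dots> \<longleftrightarrow> eventually P (tp ?ts)"
      by (rule eventually_cong[OF *]) simp
    finally show ?thesis by simp
  qed
  then show ?thesis by (simp add: filter_eq_iff eventually_filtermap)
qed

text \<open>
  A value of a function is determined by its arguments, so its type over them is an image filter.
  This and the reindexing rule compute the type of every tuple of internal objects below.
\<close>

lemma tp_Cons_function:
  assumes "ext (\<lambda>xs. \<exists>ys. xs = f ys # ys) (t # ts)"
  shows "tp (t # ts) = filtermap (\<lambda>xs. f xs # xs) (tp ts)"
proof -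
  have *: "eventually (\<lambda>xs. f (tl xs) # tl xs = xs) (tp (t # ts))"
    unfolding eventually_tp by (rule ext_mono[OF _ assms]) auto
  have tl: "ext (\<lambda>xs. P (tl xs)) (t # ts) \<longleftrightarrow> ext P ts" for P
  proof -
    have 1: "ts = map ((!) (t # ts)) (map Suc [0..<length ts])"
      by (simp add: map_nth comp_def)
    have 2: "tl xs = map ((!) xs) (map Suc [0..<length ts])" if "length xs = Suc (length ts)" for xs :: "'b list"
      using that by (auto intro!: nth_equalityI simp: nth_tl)
    have "ext P ts \<longleftrightarrow> ext (\<lambda>xs. P (map ((!) xs) (map Suc [0..<length ts]))) (t # ts)"
      by (subst 1, subst ext_reindex) auto
    also have "\<dots> \<longleftrightarrow> ext (\<lambda>xs. P (tl xs)) (t # ts)"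
      by (intro iffI; erule ext_mono[rotated]) (auto simp: 2)
    finally show ?thesis by simp
  qed
  have "eventually P (tp (t # ts)) \<longleftrightarrow> eventually (\<lambda>xs. P (f xs # xs)) (tp ts)" for P
  proof -
    have "eventually P (tp (t # ts)) \<longleftrightarrow> eventually (\<lambda>xs. P (f (tl xs) # tl xs)) (tp (t # ts))"
      by (rule eventually_cong[OF *]) simp
    also have "\<dots> \<longleftrightarrow> eventually (\<lambda>xs. P (f xs # xs)) (tp ts)"
      unfolding eventually_tp by (rule tl)
    finally show ?thesis .
  qed
  then show ?thesis by (simp add: filter_eq_iff eventually_filtermap)
qed

lemma star_fun_graph: "ext (\<lambda>xs. \<exists>ys. xs = f ys # ys) (star_fun f ts # ts)"
proof -
  let ?G = "\<lambda>xs. \<exists>ys. xs = f ys # ys"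
  have "\<exists>!t. ext ?G (t # ts)"
  proof (rule ex_ex1I)
    show "\<exists>t. ext ?G (t # ts)" unfolding ext_Ex by (rule ext_mono[OF _ ext_True]) auto
  next
    fix s t assume s: "ext ?G (s # ts)" and t: "ext ?G (t # ts)"
    let ?n = "length ts"
    let ?u = "s # t # ts"
    have S: "s # ts = map ((!) ?u) (0 # map (\<lambda>i. Suc (Suc i)) [0..<?n])"
      by (simp add: map_nth comp_def)
    have T: "t # ts = map ((!) ?u) (1 # map (\<lambda>i. Suc (Suc i)) [0..<?n])"
      by (simp add: map_nth comp_def)
    have "ext (\<lambda>xs. ?G (map ((!) xs) (0 # map (\<lambda>i. Suc (Suc i)) [0..<?n]))) ?u"
      using s by (subst (asm) S, subst (asm) ext_reindex) auto
    moreover have "ext (\<lambda>xs. ?G (map ((!) xs) (1 # map (\<lambda>i. Suc (Suc i)) [0..<?n]))) ?u"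
      using t by (subst (asm) T, subst (asm) ext_reindex) auto
    ultimately have "ext (\<lambda>xs. xs ! 0 = xs ! 1) ?u" by (rule ext_mp[rotated]) auto
    moreover have "ext (\<lambda>xs. xs ! 0 = xs ! 1) (map ((!) ?u) [0,1]) \<longleftrightarrow> ext (\<lambda>xs. xs ! 0 = xs ! 1) ?u"
      by (subst ext_reindex) auto
    ultimately show "s = t" using ext_eq[of s t] by simp
  qed
  from theI'[OF this] show ?thesis by (simp add: star_fun_def)
qed

lemma tp_star_fun: "tp (star_fun f ts # ts) = filtermap (\<lambda>xs. f xs # xs) (tp ts)"
  by (rule tp_Cons_function[OF star_fun_graph])

lemma tp_star_fun_reindex:
  assumes "set is \<subseteq> {..<length ts}"
  shows "tp (star_fun f (map ((!) ts) is) # ts) = filtermap (\<lambda>xs. f (map ((!) xs) is) # xs) (tp ts)"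
proof (rule tp_Cons_function)
  let ?t = "star_fun f (map ((!) ts) is)"
  have 1: "?t # map ((!) ts) is = map ((!) (?t # ts)) (0 # map Suc is)" by simp
  have "ext (\<lambda>xs. \<exists>ys. map ((!) xs) (0 # map Suc is) = f ys # ys) (?t # ts)"
    using star_fun_graph[of f "map ((!) ts) is"] assms
    by (subst (asm) 1, subst (asm) ext_reindex) auto
  then show "ext (\<lambda>xs. \<exists>ys. xs = f (map ((!) ys) is) # ys) (?t # ts)"
    by (rule ext_mono[rotated]) (auto simp: length_Suc_conv comp_def)
qed

lemma tp_Ex: "eventually (\<lambda>xs. \<exists>x. P (x # xs)) (tp ts) \<Longrightarrow> \<exists>t. eventually P (tp (t # ts))"
  by (simp add: eventually_tp ext_Ex)

text \<open>
  An ultrafilter on a compact set converges. This is the source of all standard parts, of points and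
  of reals alike.
\<close>

lemma tp_tendsto_of_compact:
  fixes g :: "'a entity list \<Rightarrow> 'b::metric_space"
  assumes "compact K" and "eventually (\<lambda>xs. g xs \<in> K) (tp ts)"
  obtains L where "L \<in> K" "(g \<longlongrightarrow> L) (tp ts)"
proof -
  have "filtermap g (tp ts) \<noteq> bot" by (simp add: filtermap_bot_iff)
  then obtain L where L: "L \<in> K" "inf (nhds L) (filtermap g (tp ts)) \<noteq> bot"
    using assms unfolding compact_filter by (auto simp: eventually_filtermap)
  have "(g \<longlongrightarrow> L) (tp ts)"
  proof (rule topological_tendstoI, rule ccontr)
    fix S assume S: "open S" "L \<in> S" and n: "\<not> eventually (\<lambda>xs. g xs \<in> S) (tp ts)"
    then have "eventually (\<lambda>z. z \<notin> S) (filtermap g (tp ts))"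
      by (simp add: eventually_filtermap tp_Not)
    moreover have "eventually (\<lambda>z. z \<in> S) (nhds L)" using S by (simp add: eventually_nhds_in_open)
    ultimately have "eventually (\<lambda>z. False) (inf (nhds L) (filtermap g (tp ts)))"
      unfolding eventually_inf by blast
    with L(2) show False by simp
  qed
  with L(1) show thesis by (rule that)
qed

lemma tp_star_fun_single: "tp [star_fun f ts] = filtermap (\<lambda>xs. [f xs]) (tp ts)"
proof -
  have "tp [star_fun f ts] = filtermap (\<lambda>xs. [xs ! 0]) (tp (star_fun f ts # ts))"
    using tp_reindex[of "[0]" "star_fun f ts # ts"] by simp
  then show ?thesis by (simp add: tp_star_fun filtermap_filtermap)
qed

lemma st_real_star_fun:
  assumes "eventually (\<lambda>xs. f xs = Real (g xs)) (tp ts)" and lim: "(g \<longlongrightarrow> L) (tp ts)"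
  shows "st_real (star_fun f ts) = L"
proof -
  have iff: "(\<forall>\<epsilon>>0. ext (\<lambda>xs. \<exists>a b. xs = [Real a, Real b] \<and> \<bar>a - b\<bar> < \<epsilon>) [star_fun f ts, std (Real x)])
     \<longleftrightarrow> (g \<longlongrightarrow> x) (tp ts)" for x
  proof -
    have "ext (\<lambda>xs. \<exists>a b. xs = [Real a, Real b] \<and> \<bar>a - b\<bar> < \<epsilon>) [star_fun f ts, std (Real x)]
      \<longleftrightarrow> eventually (\<lambda>xs. dist (g xs) x < \<epsilon>) (tp ts)" for \<epsilon>
    proof -
      have "ext (\<lambda>xs. \<exists>a b. xs = [Real a, Real b] \<and> \<bar>a - b\<bar> < \<epsilon>) [star_fun f ts, std (Real x)]
        \<longleftrightarrow> eventually (\<lambda>xs. \<exists>a. f xs = Real a \<and> \<bar>a - x\<bar> < \<epsilon>) (tp ts)"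
        using tp_append_std[of "[star_fun f ts]" "[Real x]"]
        by (simp add: tp_star_fun_single filtermap_filtermap eventually_filtermap flip: eventually_tp)
      also have "\<dots> \<longleftrightarrow> eventually (\<lambda>xs. dist (g xs) x < \<epsilon>) (tp ts)"
        by (rule eventually_cong[OF assms(1)]) (auto simp: dist_real_def)
      finally show ?thesis .
    qed
    then show ?thesis by (simp add: tendsto_iff)
  qed
  show ?thesis unfolding st_real_def iff
    by (rule the_equality) (auto intro: lim tendsto_unique[OF tp_neq_bot _ lim])
qed

section \<open>Internal sets\<close>

lemma elems_star_fun:
  "y \<in> elems (star_fun f ts) \<longleftrightarrow>
     eventually (\<lambda>xs. \<exists>a A. hd xs = Point a \<and> f (tl xs) = Subset A \<and> a \<in> A) (tp (y # ts))"
proof -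
  let ?is = "map Suc [0..<length ts]" and ?B = "star_fun f ts"
  have ts: "map ((!) (y # ts)) ?is = ts" by (simp add: map_nth comp_def)
  have tl: "map ((!) xs) ?is = tl xs" if "length xs = length (y # ts)" for xs :: "'c list"
    using that by (auto intro!: nth_equalityI simp: nth_tl)
  have 1: "tp (?B # y # ts) = filtermap (\<lambda>xs. f (map ((!) xs) ?is) # xs) (tp (y # ts))"
  proof -
    have "set ?is \<subseteq> {..<length (y # ts)}" by auto
    from tp_star_fun_reindex[OF this, of f] show ?thesis by (simp only: ts)
  qed
  have 2: "tp [y, ?B] = filtermap (\<lambda>xs. [xs ! 1, xs ! 0]) (tp (?B # y # ts))"
    using tp_reindex[of "[1, 0]" "?B # y # ts"] by simp
  have "y \<in> elems ?B \<longleftrightarrow>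
     eventually (\<lambda>xs. \<exists>a A. xs ! 0 = Point a \<and> f (map ((!) xs) ?is) = Subset A \<and> a \<in> A) (tp (y # ts))"
    unfolding elems_def by (simp add: 1 2 eventually_filtermap flip: eventually_tp)
  also have "\<dots> \<longleftrightarrow> eventually (\<lambda>xs. \<exists>a A. hd xs = Point a \<and> f (tl xs) = Subset A \<and> a \<in> A) (tp (y # ts))"
    by (rule eventually_cong[OF tp_length]) (auto simp: tl hd_conv_nth neq_Nil_conv length_Suc_conv simp del: map_map)
  finally show ?thesis .
qed

lemma star_set_iff: "t \<in> star_set S \<longleftrightarrow> eventually (\<lambda>xs. \<exists>s\<in>S. xs = [s]) (tp [t])"
  by (simp add: star_set_def eventually_tp)

lemma elems_iff: "y \<in> elems H \<longleftrightarrow> eventually (\<lambda>xs. \<exists>a A. xs = [Point a, Subset A] \<and> a \<in> A) (tp [y, H])"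
  by (simp add: elems_def eventually_tp)

lemma Subset_pair:
  assumes "B \<in> star_set (range Subset)" "C \<in> star_set (range Subset)"
  shows "eventually (\<lambda>xs. \<exists>A A'. xs = [Subset A, Subset A']) (tp [B, C])"
proof -
  have "eventually (\<lambda>xs. \<exists>A. [xs ! 0] = [Subset A]) (tp [B, C])"
    using assms(1) tp_reindex[of "[0]" "[B, C]"] by (simp add: star_set_iff eventually_filtermap image_iff Bex_def)
  moreover have "eventually (\<lambda>xs. \<exists>A. [xs ! 1] = [Subset A]) (tp [B, C])"
    using assms(2) tp_reindex[of "[1]" "[B, C]"] by (simp add: star_set_iff eventually_filtermap image_iff Bex_def)
  ultimately show ?thesis using tp_length[of "[B, C]"] by eventually_elim (auto simp: length_Suc_conv)
qed

text \<open>
  If an internal set is not contained in another one, then transfer provides a witness of this fact,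
  and the witness is an element of \<^typ>\<open>'t\<close>.
\<close>

lemma elems_mono_iff:
  assumes "B \<in> star_set (range Subset)" "C \<in> star_set (range Subset)"
  shows "elems B \<subseteq> elems C \<longleftrightarrow> eventually (\<lambda>xs. \<exists>A A'. xs = [Subset A, Subset A'] \<and> A \<subseteq> A') (tp [B, C])"
proof -
  note BC = Subset_pair[OF assms]
  have 01: "tp [y, B] = filtermap (\<lambda>xs. [xs ! 0, xs ! 1]) (tp [y, B, C])" for y
    using tp_reindex[of "[0, 1]" "[y, B, C]"] by simp
  have 02: "tp [y, C] = filtermap (\<lambda>xs. [xs ! 0, xs ! 2]) (tp [y, B, C])" for y
    using tp_reindex[of "[0, 2]" "[y, B, C]"] by simp
  have 12: "tp [B, C] = filtermap (\<lambda>xs. [xs ! 1, xs ! 2]) (tp [y, B, C])" for y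
    using tp_reindex[of "[1, 2]" "[y, B, C]"] by simp
  show ?thesis
  proof
    assume sub: "elems B \<subseteq> elems C"
    show "eventually (\<lambda>xs. \<exists>A A'. xs = [Subset A, Subset A'] \<and> A \<subseteq> A') (tp [B, C])"
    proof (rule ccontr)
      assume "\<not> ?thesis"
      then have "eventually (\<lambda>xs. \<not> (\<exists>A A'. xs = [Subset A, Subset A'] \<and> A \<subseteq> A')) (tp [B, C])"
        by (simp only: tp_Not not_False_eq_True)
      with BC have "eventually (\<lambda>xs. \<exists>x a A A'. x # xs = [Point a, Subset A, Subset A'] \<and> a \<in> A \<and> a \<notin> A') (tp [B, C])"
        by eventually_elim auto
      then have "\<exists>y. eventually (\<lambda>xs. \<exists>a A A'. xs = [Point a, Subset A, Subset A'] \<and> a \<in> A \<and> a \<notin> A') (tp [y, B, C])"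
        by (intro tp_Ex)
      then obtain y where y: "eventually (\<lambda>xs. \<exists>a A A'. xs = [Point a, Subset A, Subset A'] \<and> a \<in> A \<and> a \<notin> A') (tp [y, B, C])" ..
      have "y \<in> elems B" unfolding elems_iff 01 eventually_filtermap
        using y by eventually_elim auto
      moreover have "y \<notin> elems C" unfolding elems_iff 02 eventually_filtermap tp_Not[symmetric]
        using y by eventually_elim auto
      ultimately show False using sub by blast
    qed
  next
    assume sub: "eventually (\<lambda>xs. \<exists>A A'. xs = [Subset A, Subset A'] \<and> A \<subseteq> A') (tp [B, C])"
    show "elems B \<subseteq> elems C"
    proof
      fix y assume "y \<in> elems B"
      then have "eventually (\<lambda>xs. \<exists>a A. [xs ! 0, xs ! 1] = [Point a, Subset A] \<and> a \<in> A) (tp [y, B, C])"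
        by (simp add: elems_iff 01 eventually_filtermap)
      moreover have "eventually (\<lambda>xs. \<exists>A A'. [xs ! 1, xs ! 2] = [Subset A, Subset A'] \<and> A \<subseteq> A') (tp [y, B, C])"
        using sub by (simp add: 12[of y] eventually_filtermap)
      ultimately show "y \<in> elems C" unfolding elems_iff 02 eventually_filtermap
        by eventually_elim auto
    qed
  qed
qed

lemma elems_inject:
  assumes "B \<in> star_set (range Subset)" "C \<in> star_set (range Subset)" "elems B = elems C"
  shows "B = C"
proof -
  have "eventually (\<lambda>xs. \<exists>A A'. xs = [Subset A, Subset A'] \<and> A \<subseteq> A') (tp [B, C])"
    using elems_mono_iff[OF assms(1,2)] assms(3) by simp
  moreover have "eventually (\<lambda>xs. \<exists>A A'. xs = [Subset A, Subset A'] \<and> A \<subseteq> A') (tp [C, B])"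
    using elems_mono_iff[OF assms(2,1)] assms(3) by simp
  moreover have "tp [C, B] = filtermap (\<lambda>xs. [xs ! 1, xs ! 0]) (tp [B, C])"
    using tp_reindex[of "[1, 0]" "[B, C]"] by simp
  ultimately have "eventually (\<lambda>xs. \<exists>A A'. xs = [Subset A, Subset A'] \<and> A \<subseteq> A') (tp [B, C])"
    "eventually (\<lambda>xs. \<exists>A A'. [xs ! 1, xs ! 0] = [Subset A, Subset A'] \<and> A \<subseteq> A') (tp [B, C])"
    by (simp_all only: eventually_filtermap)
  then have "eventually (\<lambda>xs. xs ! 0 = xs ! 1) (tp [B, C])"
    by eventually_elim auto
  then show ?thesis using ext_eq[of B C] by (simp add: eventually_tp)
qed

definition subset_op :: "('a set \<Rightarrow> 'a set \<Rightarrow> 'a set) \<Rightarrow> 'a entity list \<Rightarrow> 'a entity" where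
  "subset_op f xs = (case xs of [Subset A, Subset A'] \<Rightarrow> Subset (f A A'))"

lemma subset_op_simp [simp]: "subset_op f [Subset A, Subset A'] = Subset (f A A')"
  by (simp add: subset_op_def)

definition star_combine :: "('a set \<Rightarrow> 'a set \<Rightarrow> 'a set) \<Rightarrow> 't \<Rightarrow> 't \<Rightarrow> 't" where
  "star_combine f B C = star_fun (subset_op f) [B, C]"

lemma star_combine_Subset:
  assumes "B \<in> star_set (range Subset)" "C \<in> star_set (range Subset)"
  shows "star_combine f B C \<in> star_set (range Subset)"
  unfolding star_combine_def star_set_iff tp_star_fun_single eventually_filtermap
  using Subset_pair[OF assms] by eventually_elim auto

lemma elems_star_combine:
  assumes "B \<in> star_set (range Subset)" "C \<in> star_set (range Subset)"
    and f: "\<And>a A A'. a \<in> f A A' \<longleftrightarrow> \<phi> (a \<in> A) (a \<in> A')" and "\<not> \<phi> False False"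
  shows "elems (star_combine f B C) = {y. \<phi> (y \<in> elems B) (y \<in> elems C)}"
proof (intro set_eqI)
  fix y
  have 01: "tp [y, B] = filtermap (\<lambda>xs. [xs ! 0, xs ! 1]) (tp [y, B, C])"
    using tp_reindex[of "[0, 1]" "[y, B, C]"] by simp
  have 02: "tp [y, C] = filtermap (\<lambda>xs. [xs ! 0, xs ! 2]) (tp [y, B, C])"
    using tp_reindex[of "[0, 2]" "[y, B, C]"] by simp
  have 12: "tp [B, C] = filtermap (\<lambda>xs. [xs ! 1, xs ! 2]) (tp [y, B, C])"
    using tp_reindex[of "[1, 2]" "[y, B, C]"] by simp
  let ?b = "\<lambda>xs. \<exists>a A. [xs ! 0, xs ! 1] = [Point a, Subset A] \<and> a \<in> A"
  let ?c = "\<lambda>xs. \<exists>a A. [xs ! 0, xs ! 2] = [Point a, Subset A] \<and> a \<in> A"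
  have B: "y \<in> elems B \<longleftrightarrow> eventually ?b (tp [y, B, C])"
    by (simp add: elems_iff 01 eventually_filtermap)
  have C: "y \<in> elems C \<longleftrightarrow> eventually ?c (tp [y, B, C])"
    by (simp add: elems_iff 02 eventually_filtermap)
  have shape: "eventually (\<lambda>xs. \<exists>A A'. xs ! 1 = Subset A \<and> xs ! 2 = Subset A') (tp [y, B, C])"
    using Subset_pair[OF assms(1,2)] by (simp add: 12 eventually_filtermap)
  have B': "eventually (\<lambda>xs. ?b xs \<longleftrightarrow> y \<in> elems B) (tp [y, B, C])"
    by (cases "y \<in> elems B") (use B tp_Not[of ?b] in auto)
  have C': "eventually (\<lambda>xs. ?c xs \<longleftrightarrow> y \<in> elems C) (tp [y, B, C])"
    by (cases "y \<in> elems C") (use C tp_Not[of ?c] in auto)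
  have "y \<in> elems (star_combine f B C) \<longleftrightarrow>
     eventually (\<lambda>xs. \<exists>a A. hd xs = Point a \<and> subset_op f (tl xs) = Subset A \<and> a \<in> A) (tp [y, B, C])"
    unfolding star_combine_def elems_star_fun ..
  also have "\<dots> \<longleftrightarrow> eventually (\<lambda>xs. \<phi> (y \<in> elems B) (y \<in> elems C)) (tp [y, B, C])"
  proof (rule eventually_cong)
    show "eventually (\<lambda>xs. (?b xs \<longleftrightarrow> y \<in> elems B) \<and> (?c xs \<longleftrightarrow> y \<in> elems C) \<and>
      (\<exists>A A' x. xs = [x, Subset A, Subset A'])) (tp [y, B, C])"
      using B' C' shape tp_length[of "[y, B, C]"] by eventually_elim (auto simp: length_Suc_conv)
  next
    fix xs :: "'a entity list"
    assume "(?b xs \<longleftrightarrow> y \<in> elems B) \<and> (?c xs \<longleftrightarrow> y \<in> elems C) \<and>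
      (\<exists>A A' x. xs = [x, Subset A, Subset A'])"
    then obtain x A A' where xs: "xs = [x, Subset A, Subset A']"
      and bc: "?b xs \<longleftrightarrow> y \<in> elems B" "?c xs \<longleftrightarrow> y \<in> elems C"
      by blast
    have b: "y \<in> elems B \<longleftrightarrow> (\<exists>a. x = Point a \<and> a \<in> A)" and c: "y \<in> elems C \<longleftrightarrow> (\<exists>a. x = Point a \<and> a \<in> A')"
      unfolding bc[symmetric] by (auto simp: xs)
    show "(\<exists>a A. hd xs = Point a \<and> subset_op f (tl xs) = Subset A \<and> a \<in> A)
      \<longleftrightarrow> \<phi> (y \<in> elems B) (y \<in> elems C)"
      using \<open>\<not> \<phi> False False\<close> by (cases x) (auto simp: xs b c f)
  qed
  also have "\<dots> \<longleftrightarrow> \<phi> (y \<in> elems B) (y \<in> elems C)"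
    by (cases "\<phi> (y \<in> elems B) (y \<in> elems C)") simp_all
  finally show "y \<in> elems (star_combine f B C) \<longleftrightarrow> y \<in> {y. \<phi> (y \<in> elems B) (y \<in> elems C)}" by simp
qed

end

section \<open>Loeb measure\<close>

definition ratio :: "'a::metric_space entity \<Rightarrow> 'a entity \<Rightarrow> real" where
  "ratio B H = (case (B, H) of (Subset A, Subset Z) \<Rightarrow> real (card A) / real (card Z))"

lemma ratio_simps [simp]: "ratio (Subset A) (Subset Z) = real (card A) / real (card Z)"
  by (simp add: ratio_def)

locale hyperfinite = nonstandard_universe std ext
  for std :: "'a::metric_space entity \<Rightarrow> 't" and ext +
  fixes H :: 't
  assumes hyperfinite: "ext (\<lambda>xs. \<exists>Z. xs = [Subset Z] \<and> finite Z \<and> Z \<noteq> {}) [H]"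
begin

lemma H_Subset: "H \<in> star_set (range Subset)"
  unfolding star_set_def mem_Collect_eq by (rule ext_mono[OF _ hyperfinite]) auto

lemma H_internal: "H \<in> internal_subsets H"
  by (simp add: internal_subsets_def H_Subset)

lemma internal_subset_type:
  assumes "B \<in> internal_subsets H"
  shows "eventually (\<lambda>xs. \<exists>A Z. xs = [Subset A, Subset Z] \<and> A \<subseteq> Z \<and> finite Z \<and> Z \<noteq> {}) (tp [B, H])"
proof -
  have "eventually (\<lambda>xs. \<exists>A A'. xs = [Subset A, Subset A'] \<and> A \<subseteq> A') (tp [B, H])"
    using elems_mono_iff[of B H] assms H_Subset by (simp add: internal_subsets_def)
  moreover have "eventually (\<lambda>xs. \<exists>Z. [xs ! 1] = [Subset Z] \<and> finite Z \<and> Z \<noteq> {}) (tp [B, H])"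
    using hyperfinite tp_reindex[of "[1]" "[B, H]"] by (simp add: eventually_filtermap flip: eventually_tp)
  ultimately show ?thesis by eventually_elim auto
qed

abbreviation loeb_content :: "'t \<Rightarrow> real" where
  "loeb_content B \<equiv> st_real (card_ratio B H)"

lemma loeb_content_tendsto:
  assumes "B \<in> internal_subsets H"
  shows "((\<lambda>xs. ratio (xs ! 0) (xs ! 1)) \<longlongrightarrow> loeb_content B) (tp [B, H])"
proof -
  have "eventually (\<lambda>xs. ratio (xs ! 0) (xs ! 1) \<in> {0..1}) (tp [B, H])"
    using internal_subset_type[OF assms]
    by eventually_elim (auto simp: divide_le_eq card_mono card_gt_0_iff)
  then obtain L where L: "((\<lambda>xs. ratio (xs ! 0) (xs ! 1)) \<longlongrightarrow> L) (tp [B, H])"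
    by (rule tp_tendsto_of_compact[OF compact_Icc])
  moreover have "loeb_content B = L" unfolding card_ratio_def
    by (rule st_real_star_fun[OF _ L])
       (use internal_subset_type[OF assms] in eventually_elim, auto)
  ultimately show ?thesis by simp
qed

lemma loeb_content_le:
  assumes "B \<in> internal_subsets H" and "eventually (\<lambda>xs. ratio (xs ! 0) (xs ! 1) \<le> c) (tp [B, H])"
  shows "loeb_content B \<le> c"
  using tendsto_upperbound[OF loeb_content_tendsto[OF assms(1)] assms(2)] by simp

lemma loeb_content_ge:
  assumes "B \<in> internal_subsets H" and "eventually (\<lambda>xs. c \<le> ratio (xs ! 0) (xs ! 1)) (tp [B, H])"
  shows "c \<le> loeb_content B"
  using tendsto_lowerbound[OF loeb_content_tendsto[OF assms(1)] assms(2)] by simp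

lemma loeb_content_nonneg: "B \<in> internal_subsets H \<Longrightarrow> 0 \<le> loeb_content B"
  by (rule loeb_content_ge, assumption)
     (drule internal_subset_type, erule eventually_mono, auto)

lemma star_combine_internal:
  assumes "B \<in> internal_subsets H" "C \<in> internal_subsets H"
    and "\<And>a A A'. a \<in> f A A' \<longleftrightarrow> \<phi> (a \<in> A) (a \<in> A')" and "\<not> \<phi> False False"
  shows "star_combine f B C \<in> internal_subsets H"
proof -
  have "B \<in> star_set (range Subset)" "C \<in> star_set (range Subset)" "elems B \<subseteq> elems H" "elems C \<subseteq> elems H"
    using assms(1,2) by (auto simp: internal_subsets_def)
  moreover from this have "elems (star_combine f B C) \<subseteq> elems H"
    using elems_star_combine[of B C f \<phi>] assms(3,4) by (smt (verit, best) mem_Collect_eq subset_eq)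
  ultimately show ?thesis using star_combine_Subset by (simp add: internal_subsets_def)
qed

lemma loeb_content_add:
  assumes B: "B \<in> internal_subsets H" and C: "C \<in> internal_subsets H" and disj: "elems B \<inter> elems C = {}"
  shows "loeb_content (star_combine (\<union>) B C) = loeb_content B + loeb_content C"
proof -
  let ?D = "star_combine (\<union>) B C"
  let ?f = "subset_op (\<union>)"
  have sub: "B \<in> star_set (range Subset)" "C \<in> star_set (range Subset)"
    using B C by (auto simp: internal_subsets_def)
  have D: "?D \<in> internal_subsets H"
    by (rule star_combine_internal[OF B C, where \<phi> = "(\<or>)"]) auto
  let ?F = "tp [B, C, H]"
  have 02: "tp [B, H] = filtermap (\<lambda>xs. [xs ! 0, xs ! 2]) ?F"
    using tp_reindex[of "[0, 2]" "[B, C, H]"] by simp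
  have 12: "tp [C, H] = filtermap (\<lambda>xs. [xs ! 1, xs ! 2]) ?F"
    using tp_reindex[of "[1, 2]" "[B, C, H]"] by simp
  have "tp (?D # [B, C, H]) = filtermap (\<lambda>xs. ?f [xs ! 0, xs ! 1] # xs) ?F"
    using tp_star_fun_reindex[of "[0, 1]" "[B, C, H]" ?f] by (simp add: star_combine_def)
  moreover have "tp [?D, H] = filtermap (\<lambda>xs. [xs ! 0, xs ! 3]) (tp (?D # [B, C, H]))"
    using tp_reindex[of "[0, 3]" "?D # [B, C, H]"] by simp
  ultimately have DH: "tp [?D, H] = filtermap (\<lambda>xs. [?f [xs ! 0, xs ! 1], xs ! 2]) ?F"
    by (simp add: filtermap_filtermap)
  \<comment> \<open>Disjointness is transferred through the internal intersection, which has no elements.\<close>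
  let ?E = "star_combine (\<inter>) B C"
  have E: "elems ?E = {}"
    using elems_star_combine[OF sub, of "(\<inter>)" "(\<and>)"] disj by auto
  have disjoint: "eventually (\<lambda>xs. \<exists>A A'. xs = [Subset A, Subset A'] \<and> A \<inter> A' = {}) (tp [B, C])"
  proof (rule ccontr)
    assume "\<not> ?thesis"
    then have "eventually (\<lambda>xs. \<not> (\<exists>A A'. xs = [Subset A, Subset A'] \<and> A \<inter> A' = {})) (tp [B, C])"
      by (simp only: tp_Not not_False_eq_True)
    with Subset_pair[OF sub]
    have "eventually (\<lambda>xs. \<exists>x a A A'. x # xs = [Point a, Subset A, Subset A'] \<and> a \<in> A \<inter> A') (tp [B, C])"
      by eventually_elim auto
      then have "\<exists>y. eventually (\<lambda>xs. \<exists>a A A'. xs = [Point a, Subset A, Subset A'] \<and> a \<in> A \<inter> A') (tp [y, B, C])"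
        by (intro tp_Ex)
      then obtain y where y: "eventually (\<lambda>xs. \<exists>a A A'. xs = [Point a, Subset A, Subset A'] \<and> a \<in> A \<inter> A') (tp [y, B, C])" ..
    have "y \<in> elems ?E" unfolding star_combine_def elems_star_fun
      using y by eventually_elim auto
    then show False using E by simp
  qed
  then have disjoint: "eventually (\<lambda>xs. \<exists>A A'. xs ! 0 = Subset A \<and> xs ! 1 = Subset A' \<and> A \<inter> A' = {}) ?F"
    using tp_reindex[of "[0, 1]" "[B, C, H]"] by (simp add: eventually_filtermap)
  have fin: "eventually (\<lambda>xs. \<exists>A Z. [xs ! 0, xs ! 2] = [Subset A, Subset Z] \<and> A \<subseteq> Z \<and> finite Z \<and> Z \<noteq> {}) ?F"
     "eventually (\<lambda>xs. \<exists>A Z. [xs ! 1, xs ! 2] = [Subset A, Subset Z] \<and> A \<subseteq> Z \<and> finite Z \<and> Z \<noteq> {}) ?F"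
    using internal_subset_type[OF B] internal_subset_type[OF C] by (simp_all add: 02 12 eventually_filtermap)
  have "((\<lambda>xs. ratio (xs ! 0) (xs ! 2) + ratio (xs ! 1) (xs ! 2)) \<longlongrightarrow> loeb_content B + loeb_content C) ?F"
    using loeb_content_tendsto[OF B] loeb_content_tendsto[OF C]
    by (intro tendsto_add) (simp_all add: 02 12 filterlim_filtermap)
  moreover have "eventually (\<lambda>xs. ratio (xs ! 0) (xs ! 2) + ratio (xs ! 1) (xs ! 2) = ratio (?f [xs ! 0, xs ! 1]) (xs ! 2)) ?F"
    using disjoint fin
    by eventually_elim (auto simp: card_Un_disjoint finite_subset add_divide_distrib)
  ultimately have "((\<lambda>xs. ratio (?f [xs ! 0, xs ! 1]) (xs ! 2)) \<longlongrightarrow> loeb_content B + loeb_content C) ?F"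
    by (rule Lim_transform_eventually)
  moreover have "((\<lambda>xs. ratio (?f [xs ! 0, xs ! 1]) (xs ! 2)) \<longlongrightarrow> loeb_content ?D) ?F"
    using loeb_content_tendsto[OF D] by (simp add: DH filterlim_filtermap)
  ultimately show ?thesis by (meson tendsto_unique tp_neq_bot)
qed

lemma internal_ring: "ring_of_sets (elems H) (elems ` internal_subsets H)"
  unfolding ring_of_sets_iff
proof (intro conjI ballI)
  show "elems ` internal_subsets H \<subseteq> Pow (elems H)" by (auto simp: internal_subsets_def)
  have un: "star_combine (\<union>) B C \<in> internal_subsets H \<and> elems (star_combine (\<union>) B C) = elems B \<union> elems C"
    and diff: "star_combine (-) B C \<in> internal_subsets H \<and> elems (star_combine (-) B C) = elems B - elems C"
    if "B \<in> internal_subsets H" "C \<in> internal_subsets H" for B C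
  proof -
    have sub: "B \<in> star_set (range Subset)" "C \<in> star_set (range Subset)"
      using that by (auto simp: internal_subsets_def)
    show "star_combine (\<union>) B C \<in> internal_subsets H \<and> elems (star_combine (\<union>) B C) = elems B \<union> elems C"
      using star_combine_internal[OF that, of "(\<union>)" "(\<or>)"] elems_star_combine[OF sub, of "(\<union>)" "(\<or>)"] by auto
    show "star_combine (-) B C \<in> internal_subsets H \<and> elems (star_combine (-) B C) = elems B - elems C"
      using star_combine_internal[OF that, of "(-)" "\<lambda>p q. p \<and> \<not> q"] elems_star_combine[OF sub, of "(-)" "\<lambda>p q. p \<and> \<not> q"] by auto
  qed
  show "{} \<in> elems ` internal_subsets H"
    using diff[OF H_internal H_internal] by (metis Diff_cancel image_eqI)
  fix a b assume "a \<in> elems ` internal_subsets H" "b \<in> elems ` internal_subsets H"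
  then obtain B C where BC: "B \<in> internal_subsets H" "C \<in> internal_subsets H" "a = elems B" "b = elems C"
    by blast
  show "a \<union> b \<in> elems ` internal_subsets H" "a - b \<in> elems ` internal_subsets H"
    using un[OF BC(1,2)] diff[OF BC(1,2)] unfolding BC(3,4) by (metis image_eqI)+
qed

lemma elems_inj_on: "inj_on elems (internal_subsets H)"
  by (rule inj_onI) (auto simp: internal_subsets_def intro: elems_inject)

text \<open>
  Saturation makes the content trivially continuous at the empty set: a decreasing sequence of
  internal sets with empty intersection is eventually empty.
\<close>

lemma internal_decseq_empty:
  assumes "\<And>i. B i \<in> internal_subsets H" "decseq (\<lambda>i. elems (B i))" "(\<Inter>i::nat. elems (B i)) = {}"
  obtains k where "elems (B k) = {}"
proof (rule ccontr)
  assume "\<not> thesis"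
  then have ne: "elems (B k) \<noteq> {}" for k using that by blast
  have "(\<Inter>i. elems (B i)) \<noteq> {}"
  proof (rule saturation)
    show "\<exists>R ps. elems (B n) = {t. ext R (t # ps)}" for n unfolding elems_def by blast
    have "elems (B n) \<subseteq> (\<Inter>k\<le>n. elems (B k))" for n using assms(2) by (auto simp: decseq_def)
    then show "(\<Inter>k\<le>n. elems (B k)) \<noteq> {}" for n using ne[of n] by blast
  qed
  with assms(3) show False by simp
qed

text \<open>
  The content as a function of the actual set of elements. This is legitimate because an internal
  set is determined by its elements.
\<close>

definition algebra_measure :: "'t set \<Rightarrow> ennreal" where
  "algebra_measure S = ennreal (loeb_content (inv_into (internal_subsets H) elems S))"

lemma algebra_measure_elems:
  "B \<in> internal_subsets H \<Longrightarrow> algebra_measure (elems B) = ennreal (loeb_content B)"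
  by (simp add: algebra_measure_def inv_into_f_f[OF elems_inj_on])

lemma loeb_content_empty: "B \<in> internal_subsets H \<Longrightarrow> elems B = {} \<Longrightarrow> loeb_content B = 0"
  using loeb_content_add[of B B] elems_inject[of "star_combine (\<union>) B B" B]
    elems_star_combine[of B B "(\<union>)" "(\<or>)"] star_combine_Subset[of B B]
  by (auto simp: internal_subsets_def)

lemma Loeb_extension:
  "\<exists>\<mu>. (\<forall>B\<in>internal_subsets H. \<mu> (elems B) = ennreal (loeb_content B)) \<and>
       measure_space (elems H) (sigma_sets (elems H) (elems ` internal_subsets H)) \<mu>"
proof -
  interpret ring_of_sets "elems H" "elems ` internal_subsets H" by (rule internal_ring)
  have "\<exists>\<mu>. (\<forall>S\<in>elems ` internal_subsets H. \<mu> S = algebra_measure S) \<and>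
       measure_space (elems H) (sigma_sets (elems H) (elems ` internal_subsets H)) \<mu>"
  proof (rule caratheodory_empty_continuous)
    show "positive (elems ` internal_subsets H) algebra_measure"
      unfolding positive_def using algebra_measure_elems loeb_content_empty
      by (metis empty_sets ennreal_0 imageE)
    show "additive (elems ` internal_subsets H) algebra_measure"
      unfolding additive_def
    proof (intro ballI impI)
      fix x y assume "x \<in> elems ` internal_subsets H" "y \<in> elems ` internal_subsets H" and xy: "x \<inter> y = {}"
      then obtain B C where B: "B \<in> internal_subsets H" "x = elems B" and C: "C \<in> internal_subsets H" "y = elems C"
        by auto
      have "star_combine (\<union>) B C \<in> internal_subsets H"
        using star_combine_internal[OF B(1) C(1), of "(\<union>)" "(\<or>)"] by auto
      moreover have "elems (star_combine (\<union>) B C) = x \<union> y"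
        using elems_star_combine[of B C "(\<union>)" "(\<or>)"] B C by (auto simp: internal_subsets_def)
      ultimately show "algebra_measure (x \<union> y) = algebra_measure x + algebra_measure y"
        using algebra_measure_elems[of "star_combine (\<union>) B C"] algebra_measure_elems[OF B(1)]
          algebra_measure_elems[OF C(1)] loeb_content_add[OF B(1) C(1)] xy B C
        by (simp add: ennreal_plus loeb_content_nonneg)
    qed
    show "algebra_measure A \<noteq> \<infinity>" for A by (simp add: algebra_measure_def)
    fix A :: "nat \<Rightarrow> 't set"
    assume A: "range A \<subseteq> elems ` internal_subsets H" "decseq A" "(\<Inter>i. A i) = {}"
    then have "\<forall>i. \<exists>B. B \<in> internal_subsets H \<and> A i = elems B" by blast
    then obtain B where B: "\<And>i. B i \<in> internal_subsets H" "A = (\<lambda>i. elems (B i))" by metis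
    obtain k where k: "elems (B k) = {}"
      using internal_decseq_empty[of B] A B by auto
    have "algebra_measure (A i) = 0" if "k \<le> i" for i
    proof -
      have "elems (B i) = {}" using A(2) k that B(2) by (auto simp: decseq_def)
      then show ?thesis using algebra_measure_elems[OF B(1)[of i]] loeb_content_empty[OF B(1)[of i]] B(2)
        by simp
    qed
    then show "(\<lambda>i. algebra_measure (A i)) \<longlonglongrightarrow> 0"
      by (intro tendsto_eventually) (auto simp: eventually_sequentially)
  qed
  then show ?thesis using algebra_measure_elems by auto
qed

text \<open>
  The measure whose completion is the Loeb measure.
\<close>

definition raw_loeb :: "'t measure" where
  "raw_loeb = extend_measure (elems H) (internal_subsets H) elems (\<lambda>B. ennreal (loeb_content B))"

lemma loeb_eq: "loeb H = completion raw_loeb" by (simp add: loeb_def raw_loeb_def)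

lemma internal_into: "elems ` internal_subsets H \<subseteq> Pow (elems H)"
  by (auto simp: internal_subsets_def)

lemma space_raw_loeb [simp]: "space raw_loeb = elems H"
  unfolding raw_loeb_def by (rule space_extend_measure[OF internal_into])

lemma elems_in_raw_loeb: "B \<in> internal_subsets H \<Longrightarrow> elems B \<in> sets raw_loeb"
  unfolding raw_loeb_def sets_extend_measure[OF internal_into] by auto

lemma emeasure_raw_loeb_elems:
  assumes "B \<in> internal_subsets H"
  shows "emeasure raw_loeb (elems B) = ennreal (loeb_content B)"
proof -
  obtain \<mu> where \<mu>: "\<forall>B\<in>internal_subsets H. \<mu> (elems B) = ennreal (loeb_content B)"
       "measure_space (elems H) (sigma_sets (elems H) (elems ` internal_subsets H)) \<mu>"
    using Loeb_extension by blast
  show ?thesis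
    by (rule emeasure_extend_measure[OF raw_loeb_def _ internal_into _ _ assms, of \<mu>])
       (use \<mu> in \<open>auto simp: measure_space_def raw_loeb_def sets_extend_measure[OF internal_into]\<close>)
qed

lemma prob_space_raw_loeb: "prob_space raw_loeb"
proof
  have "loeb_content H = 1"
  proof (rule antisym)
    have "eventually (\<lambda>xs. ratio (xs ! 0) (xs ! 1) = 1) (tp [H, H])"
    proof -
      have "tp [H, H] = filtermap (\<lambda>xs. [xs ! 0, xs ! 0]) (tp [H])"
        using tp_reindex[of "[0, 0]" "[H]"] by simp
      moreover have "eventually (\<lambda>xs. \<exists>Z. xs = [Subset Z] \<and> finite Z \<and> Z \<noteq> {}) (tp [H])"
        using hyperfinite by (simp add: eventually_tp)
      ultimately show ?thesis
        by (simp only: eventually_filtermap) (elim eventually_mono, auto split: if_splits)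
    qed
    then show "loeb_content H \<le> 1" "1 \<le> loeb_content H"
      by (intro loeb_content_le loeb_content_ge H_internal; elim eventually_mono; simp)+
  qed
  then show "emeasure raw_loeb (space raw_loeb) = 1"
    by (simp add: emeasure_raw_loeb_elems[OF H_internal])
qed

lemma space_loeb [simp]: "space (loeb H) = elems H"
  by (simp add: loeb_eq)

lemma elems_in_loeb: "B \<in> internal_subsets H \<Longrightarrow> elems B \<in> sets (loeb H)"
  unfolding loeb_eq by (rule sets_completionI_sets[OF elems_in_raw_loeb])

lemma emeasure_loeb_elems:
  "B \<in> internal_subsets H \<Longrightarrow> emeasure (loeb H) (elems B) = ennreal (loeb_content B)"
  using elems_in_raw_loeb[of B] sets_completionI_sets[OF elems_in_raw_loeb[of B]]
  by (simp add: loeb_eq main_part_sets emeasure_raw_loeb_elems)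

lemma measure_loeb_elems:
  "B \<in> internal_subsets H \<Longrightarrow> measure (loeb H) (elems B) = loeb_content B"
  by (simp add: measure_def emeasure_loeb_elems loeb_content_nonneg)

lemma prob_space_loeb: "prob_space (loeb H)"
  using prob_space_raw_loeb unfolding loeb_eq by (rule prob_space.prob_space_completion)

end

section \<open>Terms of a sequence at infinite indices, and standard parts\<close>

context nonstandard_universe
begin

text \<open>
  An infinite hypernatural number lies beyond every standard one, so it has all properties that hold
  from some standard index on.
\<close>

lemma infinite_hypernat_type:
  assumes "infinite_hypernat N" and "eventually Q sequentially"
  shows "eventually (\<lambda>xs. \<exists>n. xs = [Natural n] \<and> Q n) (tp [N])"
proof -
  obtain m where m: "\<And>n. n \<ge> m \<Longrightarrow> Q n" using assms(2) unfolding eventually_sequentially by blast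
  have "tp [std (Natural m), N] = filtermap (\<lambda>xs. [xs ! 1, xs ! 0]) (tp [N, std (Natural m)])"
    using tp_reindex[of "[1, 0]" "[N, std (Natural m)]"] by simp
  moreover have "tp [N, std (Natural m)] = filtermap (\<lambda>xs. xs @ [Natural m]) (tp [N])"
    using tp_append_std[of "[N]" "[Natural m]"] by simp
  moreover have "eventually (\<lambda>xs. \<exists>i j. xs = [Natural i, Natural j] \<and> i < j) (tp [std (Natural m), N])"
    using assms(1) by (simp add: infinite_hypernat_def eventually_tp)
  ultimately have "eventually (\<lambda>xs. \<exists>i j. [(xs @ [Natural m]) ! 1, (xs @ [Natural m]) ! 0] = [Natural i, Natural j] \<and> i < j) (tp [N])"
    by (simp only: eventually_filtermap)
  then show ?thesis using tp_length[of "[N]"]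
    by eventually_elim (auto simp: length_Suc_conv intro!: m)
qed

lemma hypernat_type:
  "infinite_hypernat N \<Longrightarrow> eventually (\<lambda>xs. \<exists>n. xs = [Natural n]) (tp [N])"
  using infinite_hypernat_type[of N "\<lambda>_. True"] by simp

abbreviation seq_set :: "(nat \<Rightarrow> 'a set) \<Rightarrow> 'a entity list \<Rightarrow> 'a entity" where
  "seq_set S xs \<equiv> (case xs of [Natural n] \<Rightarrow> Subset (S n))"

lemma pair_type:
  assumes "infinite_hypernat N"
  shows "eventually (\<lambda>xs. \<exists>x n. xs = [x, Natural n]) (tp [y, N])"
proof -
  have "eventually (\<lambda>xs. \<exists>n. [xs ! 1] = [Natural n] \<and> True) (tp [y, N])"
    using hypernat_type[OF assms] tp_reindex[of "[1]" "[y, N]"]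
    by (simp add: eventually_filtermap)
  then show ?thesis using tp_length[of "[y, N]"] by eventually_elim (auto simp: length_Suc_conv)
qed

lemma elems_star_sets:
  assumes N: "infinite_hypernat N"
  shows "y \<in> elems (star_sets S N) \<longleftrightarrow>
    eventually (\<lambda>xs. \<exists>a n. xs = [Point a, Natural n] \<and> a \<in> S n) (tp [y, N])"
  unfolding star_sets_def elems_star_fun
  by (rule eventually_cong[OF pair_type[OF N]]) auto

text \<open>
  Both sets are functions of \<open>N\<close>, so the ratio of their cardinalities has the same limit as the
  sequence of ratios along the type of \<open>N\<close>.
\<close>

lemma star_sets_pair:
  "tp [star_sets S N, star_sets Y N] = filtermap (\<lambda>xs. [seq_set S xs, seq_set Y xs]) (tp [N])"
proof -
  have 1: "tp [star_sets Y N, N] = filtermap (\<lambda>xs. seq_set Y xs # xs) (tp [N])"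
    unfolding star_sets_def by (rule tp_star_fun)
  have 2: "tp [star_sets S N, star_sets Y N, N] = filtermap (\<lambda>xs. seq_set S [xs ! 1] # xs) (tp [star_sets Y N, N])"
    using tp_star_fun_reindex[of "[1]" "[star_sets Y N, N]" "seq_set S"] by (simp add: star_sets_def)
  have 3: "tp [star_sets S N, star_sets Y N] = filtermap (\<lambda>xs. [xs ! 0, xs ! 1]) (tp [star_sets S N, star_sets Y N, N])"
    using tp_reindex[of "[0, 1]" "[star_sets S N, star_sets Y N, N]"] by simp
  show ?thesis unfolding 3 2 1 filtermap_filtermap filter_eq_iff eventually_filtermap
    by (intro allI eventually_cong[OF tp_length[of "[N]"]]) (auto simp: length_Suc_conv)
qed

lemma star_sets_Subset:
  assumes "infinite_hypernat N" shows "star_sets S N \<in> star_set (range Subset)"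
  unfolding star_sets_def star_set_iff tp_star_fun_single eventually_filtermap
  using hypernat_type[OF assms] by eventually_elim auto

lemma hyperfinite_star_sets:
  assumes "infinite_hypernat N" "\<And>n. finite (Y n)" "\<And>n. Y n \<noteq> {}"
  shows "hyperfinite std ext (star_sets Y N)"
proof
  have "eventually (\<lambda>xs. \<exists>Z. xs = [Subset Z] \<and> finite Z \<and> Z \<noteq> {}) (tp [star_sets Y N])"
    unfolding star_sets_def tp_star_fun_single eventually_filtermap
    using hypernat_type[OF assms(1)]
    by eventually_elim (use assms(2,3) in auto)
  then show "ext (\<lambda>xs. \<exists>Z. xs = [Subset Z] \<and> finite Z \<and> Z \<noteq> {}) [star_sets Y N]"
    by (simp only: eventually_tp)
qed

lemma star_sets_internal:
  assumes "infinite_hypernat N" "\<And>n. S n \<subseteq> Y n"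
  shows "star_sets S N \<in> internal_subsets (star_sets Y N)"
proof -
  have "elems (star_sets S N) \<subseteq> elems (star_sets Y N)"
  proof
    fix y assume "y \<in> elems (star_sets S N)"
    then show "y \<in> elems (star_sets Y N)" unfolding elems_star_sets[OF assms(1)]
      by eventually_elim (use assms(2) in blast)
  qed
  then show ?thesis using star_sets_Subset[OF assms(1)] by (simp add: internal_subsets_def)
qed

lemma measure_loeb_star_sets_le:
  assumes N: "infinite_hypernat N" and Y: "\<And>n. finite (Y n)" "\<And>n. Y n \<noteq> {}" and S: "\<And>n. S n \<subseteq> Y n"
    and ev: "eventually (\<lambda>n. real (card (S n)) / real (card (Y n)) \<le> c) sequentially"
  shows "measure (loeb (star_sets Y N)) (elems (star_sets S N)) \<le> c"
proof -
  interpret hyperfinite std ext "star_sets Y N" by (rule hyperfinite_star_sets[OF N Y])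
  note int = star_sets_internal[where S = S and Y = Y, OF N S]
  show ?thesis unfolding measure_loeb_elems[OF int]
  proof (rule loeb_content_le[OF int])
    show "eventually (\<lambda>xs. ratio (xs ! 0) (xs ! 1) \<le> c) (tp [star_sets S N, star_sets Y N])"
      unfolding star_sets_pair eventually_filtermap
      using infinite_hypernat_type[OF N ev] by eventually_elim auto
  qed
qed

lemma measure_loeb_star_sets_ge:
  assumes N: "infinite_hypernat N" and Y: "\<And>n. finite (Y n)" "\<And>n. Y n \<noteq> {}" and S: "\<And>n. S n \<subseteq> Y n"
    and ev: "eventually (\<lambda>n. c \<le> real (card (S n)) / real (card (Y n))) sequentially"
  shows "c \<le> measure (loeb (star_sets Y N)) (elems (star_sets S N))"
proof -
  interpret hyperfinite std ext "star_sets Y N" by (rule hyperfinite_star_sets[OF N Y])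
  note int = star_sets_internal[where S = S and Y = Y, OF N S]
  show ?thesis unfolding measure_loeb_elems[OF int]
  proof (rule loeb_content_ge[OF int])
    show "eventually (\<lambda>xs. c \<le> ratio (xs ! 0) (xs ! 1)) (tp [star_sets S N, star_sets Y N])"
      unfolding star_sets_pair eventually_filtermap
      using infinite_hypernat_type[OF N ev] by eventually_elim auto
  qed
qed

lemma near_std_iff:
  "near y (std (Point x)) \<longleftrightarrow> (\<forall>\<epsilon>>0. eventually (\<lambda>xs. \<exists>a. xs = [Point a] \<and> dist a x < \<epsilon>) (tp [y]))"
proof -
  have "tp [y, std (Point x)] = filtermap (\<lambda>xs. xs @ [Point x]) (tp [y])"
    using tp_append_std[of "[y]" "[Point x]"] by simp
  moreover have "near y (std (Point x)) \<longleftrightarrow> (\<forall>\<epsilon>>0.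
      eventually (\<lambda>xs. \<exists>a b. xs = [Point a, Point b] \<and> dist a b < \<epsilon>) (tp [y, std (Point x)]))"
    by (simp only: near_def eventually_tp)
  ultimately show ?thesis by (simp add: eventually_filtermap)
qed

lemma near_std_unique:
  assumes "near y (std (Point x))" "near y (std (Point x'))"
  shows "x = x'"
proof (rule ccontr)
  assume "x \<noteq> x'"
  then have "dist x x' / 2 > 0" by simp
  with assms have "eventually (\<lambda>xs. \<exists>a. xs = [Point a] \<and> dist a x < dist x x' / 2) (tp [y])"
    "eventually (\<lambda>xs. \<exists>a. xs = [Point a] \<and> dist a x' < dist x x' / 2) (tp [y])"
    unfolding near_std_iff by blast+
  then have "eventually (\<lambda>xs. False) (tp [y])"
  proof eventually_elim
    case (elim xs)
    then obtain a where "dist a x < dist x x' / 2" "dist a x' < dist x x' / 2" by auto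
    then show False by (metis dist_triangle_half_r less_irrefl)
  qed
  then show False by simp
qed

lemma near_st:
  assumes "compact (UNIV :: 'a set)" and y: "y \<in> star_set (range Point)"
  shows "near y (std (Point (st y)))"
proof -
  let ?p = "\<lambda>xs. case xs of [Point a] \<Rightarrow> a"
  have pt: "eventually (\<lambda>xs. \<exists>a. xs = [Point a]) (tp [y])"
    using y unfolding star_set_iff by eventually_elim auto
  obtain x where x: "(?p \<longlongrightarrow> x) (tp [y])"
    by (rule tp_tendsto_of_compact[OF assms(1), of ?p "[y]"]) auto
  have "near y (std (Point x))" unfolding near_std_iff
  proof (intro allI impI)
    fix \<epsilon> :: real assume "\<epsilon> > 0"
    then have "eventually (\<lambda>xs. dist (?p xs) x < \<epsilon>) (tp [y])" using x by (simp add: tendsto_iff)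
    with pt show "eventually (\<lambda>xs. \<exists>a. xs = [Point a] \<and> dist a x < \<epsilon>) (tp [y])"
      by eventually_elim auto
  qed
  then show ?thesis unfolding st_def by (rule theI) (rule near_std_unique[OF _ \<open>near y (std (Point x))\<close>])
qed

lemma elems_Point: "y \<in> elems B \<Longrightarrow> y \<in> star_set (range Point)"
  using tp_reindex[of "[0]" "[y, B]"]
  by (auto simp: elems_iff star_set_iff eventually_filtermap elim!: eventually_mono)

text \<open>
  A point of \<open>*X\<close> lies infinitely close to \<open>C\<close> exactly if its distance to \<open>C\<close> is below every standard
  positive bound, and a closed set contains the standard parts of such points.
\<close>

lemma st_vimage_closed:
  assumes comp: "compact (UNIV :: 'a set)" and N: "infinite_hypernat N"
    and C: "closed C" "C \<noteq> {}"
  shows "st -` C \<inter> elems (star_sets Y N) =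
    (\<Inter>k::nat. elems (star_sets (\<lambda>n. {y \<in> Y n. infdist y C < 1 / Suc k}) N))"
proof (intro set_eqI iffI)
  fix y assume "y \<in> st -` C \<inter> elems (star_sets Y N)"
  then have y: "st y \<in> C" "y \<in> elems (star_sets Y N)" by auto
  have near: "near y (std (Point (st y)))" by (rule near_st[OF comp elems_Point[OF y(2)]])
  show "y \<in> (\<Inter>k::nat. elems (star_sets (\<lambda>n. {y \<in> Y n. infdist y C < 1 / Suc k}) N))"
  proof
    fix k :: nat
    have "eventually (\<lambda>xs. \<exists>a. xs = [Point a] \<and> dist a (st y) < 1 / Suc k) (tp [y])"
      using near unfolding near_std_iff by simp
    then have "eventually (\<lambda>xs. \<exists>a. [xs ! 0] = [Point a] \<and> dist a (st y) < 1 / Suc k) (tp [y, N])"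
      using tp_reindex[of "[0]" "[y, N]"] by (simp add: eventually_filtermap)
    moreover have "eventually (\<lambda>xs. \<exists>a n. xs = [Point a, Natural n] \<and> a \<in> Y n) (tp [y, N])"
      using y(2) by (simp add: elems_star_sets[OF N])
    ultimately show "y \<in> elems (star_sets (\<lambda>n. {y \<in> Y n. infdist y C < 1 / Suc k}) N)"
      unfolding elems_star_sets[OF N]
      by eventually_elim (use y(1) in \<open>auto intro: le_less_trans[OF infdist_le]\<close>)
  qed
next
  fix y assume y: "y \<in> (\<Inter>k::nat. elems (star_sets (\<lambda>n. {y \<in> Y n. infdist y C < 1 / Suc k}) N))"
  then have *: "eventually (\<lambda>xs. \<exists>a n. xs = [Point a, Natural n] \<and> a \<in> Y n \<and> infdist a C < 1 / Suc k) (tp [y, N])" for k :: nat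
    by (simp add: elems_star_sets[OF N])
  then have yY: "y \<in> elems (star_sets Y N)"
    unfolding elems_star_sets[OF N] using *[of 0] by (elim eventually_mono) blast
  have near: "near y (std (Point (st y)))" by (rule near_st[OF comp elems_Point[OF yY]])
  have "infdist (st y) C \<le> 2 / Suc k" for k :: nat
  proof -
    have "eventually (\<lambda>xs. \<exists>a. xs = [Point a] \<and> dist a (st y) < 1 / Suc k) (tp [y])"
      using near unfolding near_std_iff by simp
    then have "eventually (\<lambda>xs. \<exists>a. [xs ! 0] = [Point a] \<and> dist a (st y) < 1 / Suc k) (tp [y, N])"
      using tp_reindex[of "[0]" "[y, N]"] by (simp add: eventually_filtermap)
    with *[of k] have "eventually (\<lambda>xs. infdist (st y) C \<le> 2 / Suc k) (tp [y, N])"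
    proof eventually_elim
      case (elim xs)
      then obtain a where a: "infdist a C < 1 / Suc k" "dist a (st y) < 1 / Suc k" by auto
      have "infdist (st y) C \<le> infdist a C + dist (st y) a" by (rule infdist_triangle)
      then show ?case using a by (simp add: dist_commute)
    qed
    then show ?thesis by (simp add: eventually_const)
  qed
  moreover have "(\<lambda>k. 2 / real (Suc k)) \<longlonglongrightarrow> 0"
    by (rule LIMSEQ_Suc[OF lim_const_over_n])
  ultimately have "infdist (st y) C \<le> 0" by (meson LIMSEQ_le_const)
  then have "st y \<in> C" using C infdist_nonneg[of "st y" C] by (simp add: in_closed_iff_infdist_zero)
  with yY show "y \<in> st -` C \<inter> elems (star_sets Y N)" by simp
qed

end

section \<open>The standard part map is measure preserving\<close>

text \<open>
  A continuous function between the indicators of the \<open>r\<close>-neighbourhood and the \<open>s\<close>-neighbourhood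
  of \<open>C\<close>. It transports weak convergence to bounds for the frequencies of these neighbourhoods.
\<close>

definition bump :: "'a::metric_space set \<Rightarrow> real \<Rightarrow> real \<Rightarrow> 'a \<Rightarrow> real" where
  "bump C r s x = max 0 (min 1 ((s - infdist x C) / (s - r)))"

lemma bump_bounds:
  assumes "r < s"
  shows "0 \<le> bump C r s x" "bump C r s x \<le> 1" "infdist x C < r \<Longrightarrow> bump C r s x = 1"
    "infdist x C \<ge> s \<Longrightarrow> bump C r s x = 0"
  using assms by (auto simp: bump_def le_divide_eq divide_le_eq min_def max_def field_simps)

lemma continuous_bump: "continuous_on UNIV (bump C r s)"
  unfolding bump_def divide_inverse by (intro continuous_intros)

locale weakly_approximated = prob_space \<nu> for \<nu> :: "'a::metric_space measure" +
  fixes Y :: "nat \<Rightarrow> 'a set"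
  assumes sets_eq: "sets \<nu> = sets borel"
    and fin: "finite (Y n)" and ne: "Y n \<noteq> {}"
    and weak_convergence: "approximates_space Y \<nu>"
begin

lemma weak:
  fixes f :: "'a \<Rightarrow> real"
  shows "continuous_on UNIV f \<Longrightarrow> (\<lambda>n. (\<Sum>y\<in>Y n. f y) / real (card (Y n))) \<longlonglongrightarrow> (\<integral>x. f x \<partial>\<nu>)"
  using weak_convergence approximates_space_iff[of Y \<nu>] fin ne by blast

lemma space_eq: "space \<nu> = UNIV" using sets_eq_imp_space_eq[OF sets_eq] by simp

lemma infdist_sets: "{x. infdist x C < r} \<in> sets \<nu>"
  unfolding sets_eq by (intro borel_open open_Collect_less continuous_intros)

lemma integrable_bump: "r < s \<Longrightarrow> integrable \<nu> (bump C r s)"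
proof (rule integrable_const_bound[of _ 1])
  show "bump C r s \<in> borel_measurable \<nu>"
    using borel_measurable_continuous_onI[OF continuous_bump] measurable_cong_sets[OF sets_eq refl] by blast
qed (auto simp: bump_bounds)

lemma eventually_card_le:
  assumes "r < s" "measure \<nu> {x. infdist x C < s} < c"
  shows "eventually (\<lambda>n. real (card {y\<in>Y n. infdist y C < r}) / real (card (Y n)) \<le> c) sequentially"
proof -
  have "(\<integral>x. bump C r s x \<partial>\<nu>) \<le> (\<integral>x. indicator {x. infdist x C < s} x \<partial>\<nu>)"
    by (rule integral_mono)
       (use assms(1) infdist_sets in \<open>auto simp: integrable_bump bump_bounds less_top[symmetric]
          split: split_indicator\<close>)
  also have "\<dots> = measure \<nu> {x. infdist x C < s}"
    by (simp add: space_eq)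
  finally have "(\<integral>x. bump C r s x \<partial>\<nu>) < c" using assms(2) by simp
  with weak[OF continuous_bump] have "eventually (\<lambda>n. (\<Sum>y\<in>Y n. bump C r s y) / real (card (Y n)) < c) sequentially"
    by (rule order_tendstoD)
  then show ?thesis
  proof eventually_elim
    case (elim n)
    have "real (card {y\<in>Y n. infdist y C < r}) = (\<Sum>y\<in>{y\<in>Y n. infdist y C < r}. bump C r s y)"
      using assms(1) by (simp add: bump_bounds)
    also have "\<dots> \<le> (\<Sum>y\<in>Y n. bump C r s y)"
      using assms(1) fin by (intro sum_mono2) (auto simp: bump_bounds)
    finally show ?case using elim by (meson divide_right_mono less_imp_le of_nat_0_le_iff order_trans)
  qed
qed

lemma eventually_card_ge:
  assumes "r < s" "c < measure \<nu> {x. infdist x C < r}"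
  shows "eventually (\<lambda>n. c \<le> real (card {y\<in>Y n. infdist y C < s}) / real (card (Y n))) sequentially"
proof -
  have "c < measure \<nu> {x. infdist x C < r}" by fact
  also have "\<dots> = (\<integral>x. indicator {x. infdist x C < r} x \<partial>\<nu>)"
    by (simp add: space_eq)
  also have "\<dots> \<le> (\<integral>x. bump C r s x \<partial>\<nu>)"
    by (rule integral_mono)
       (use assms(1) infdist_sets in \<open>auto simp: integrable_bump bump_bounds less_top[symmetric]
          split: split_indicator\<close>)
  finally have "eventually (\<lambda>n. c < (\<Sum>y\<in>Y n. bump C r s y) / real (card (Y n))) sequentially"
    using weak[OF continuous_bump] by (intro order_tendstoD)
  then show ?thesis
  proof eventually_elim
    case (elim n)
    have "(\<Sum>y\<in>Y n. bump C r s y) = (\<Sum>y\<in>{y\<in>Y n. infdist y C < s}. bump C r s y)"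
    proof (rule sum.mono_neutral_right)
      show "\<forall>y\<in>Y n - {y\<in>Y n. infdist y C < s}. bump C r s y = 0"
        using bump_bounds(4)[OF assms(1)] by (metis (lifting) DiffE mem_Collect_eq not_less)
    qed (use fin in auto)
    also have "\<dots> \<le> real (card {y\<in>Y n. infdist y C < s})"
      using sum_bounded_above[of "{y\<in>Y n. infdist y C < s}" "bump C r s" 1] assms(1) by (simp add: bump_bounds)
    finally show ?case using elim by (meson divide_right_mono less_imp_le of_nat_0_le_iff order_trans)
  qed
qed

end

context nonstandard_universe
begin

text \<open>
  The preimage is a decreasing intersection of internal sets. By weak convergence, the Loeb measure
  of each of them is at least \<open>\<nu> C\<close> and at most the measure of any larger neighbourhood of \<open>C\<close>, and the
  measures of these neighbourhoods tend to \<open>\<nu> C\<close>.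
\<close>

lemma loeb_st_closed:
  assumes comp: "compact (UNIV :: 'a set)" and N: "infinite_hypernat N"
    and Y: "weakly_approximated \<nu> Y" and C: "closed C" "C \<noteq> {}"
  shows "st -` C \<inter> elems (star_sets Y N) \<in> sets (loeb (star_sets Y N))"
    and "measure (loeb (star_sets Y N)) (st -` C \<inter> elems (star_sets Y N)) = measure \<nu> C"
proof -
  interpret weakly_approximated \<nu> Y by fact
  interpret hyperfinite std ext "star_sets Y N" by (rule hyperfinite_star_sets[OF N fin ne])
  let ?M = "loeb (star_sets Y N)"
  interpret M: prob_space ?M by (rule prob_space_loeb)
  let ?U = "\<lambda>k. {x. infdist x C < 1 / real (Suc k)}"
  let ?E = "\<lambda>k. elems (star_sets (\<lambda>n. {y \<in> Y n. infdist y C < 1 / Suc k}) N)"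
  have E: "?E k \<in> sets ?M" for k
    by (rule elems_in_loeb, rule star_sets_internal[OF N]) auto
  have eq: "st -` C \<inter> elems (star_sets Y N) = (\<Inter>k. ?E k)"
    by (rule st_vimage_closed[OF comp N C])
  show "st -` C \<inter> elems (star_sets Y N) \<in> sets ?M"
    unfolding eq using E by (intro sets.countable_INT) auto
  have dec: "1 / real (Suc l) \<le> 1 / real (Suc k)" if "k \<le> l" for k l
    using that by (simp add: frac_le)
  have "decseq ?E"
  proof (rule antimonoI, rule subsetI)
    fix k l y assume "k \<le> (l::nat)" "y \<in> ?E l"
    then show "y \<in> ?E k" unfolding elems_star_sets[OF N]
      by (elim eventually_mono) (use dec[of k l] in force)
  qed
  then have limE: "(\<lambda>k. measure ?M (?E k)) \<longlonglongrightarrow> measure ?M (\<Inter>k. ?E k)"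
    using E by (intro M.finite_Lim_measure_decseq) auto
  have UC: "(\<Inter>k. ?U k) = C"
  proof (intro set_eqI iffI)
    fix x assume "x \<in> (\<Inter>k. ?U k)"
    then have "infdist x C \<le> 1 / real (Suc k)" for k by (simp add: less_imp_le)
    moreover have "(\<lambda>k. 1 / real (Suc k)) \<longlonglongrightarrow> 0" by (rule LIMSEQ_Suc[OF lim_const_over_n])
    ultimately have "infdist x C \<le> 0" by (meson LIMSEQ_le_const)
    then show "x \<in> C" using C infdist_nonneg[of x C] by (simp add: in_closed_iff_infdist_zero)
  qed (use C in auto)
  have "decseq ?U" 
  proof (rule antimonoI, rule subsetI)
    fix k l x assume "k \<le> (l::nat)" "x \<in> ?U l"
    then show "x \<in> ?U k" using dec[of k l] by simp
  qed
  then have limU: "(\<lambda>k. measure \<nu> (?U k)) \<longlonglongrightarrow> measure \<nu> C"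
    using finite_Lim_measure_decseq[of ?U] infdist_sets unfolding UC by blast
  have step: "1 / real (Suc (Suc k)) < 1 / real (Suc k)" for k
    by (intro divide_strict_left_mono) auto
  have upper: "measure ?M (?E (Suc k)) \<le> measure \<nu> (?U k)" for k
  proof (rule dense_ge)
    fix c assume "measure \<nu> (?U k) < c"
    then show "measure ?M (?E (Suc k)) \<le> c"
      by (intro measure_loeb_star_sets_le[OF N fin ne _ eventually_card_le[OF step]]) auto
  qed
  have lower: "measure \<nu> C \<le> measure ?M (?E k)" for k
  proof (rule dense_le)
    fix c assume c: "c < measure \<nu> C"
    have "measure \<nu> C \<le> measure \<nu> (?U (Suc k))"
      by (rule finite_measure_mono) (use UC infdist_sets in blast)+
    with c show "c \<le> measure ?M (?E k)"
      by (intro measure_loeb_star_sets_ge[OF N fin ne _ eventually_card_ge[OF step]]) auto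
  qed
  have "measure ?M (\<Inter>k. ?E k) \<le> measure \<nu> C"
    by (rule LIMSEQ_le[OF LIMSEQ_Suc[OF limE] limU]) (use upper in auto)
  moreover have "measure \<nu> C \<le> measure ?M (\<Inter>k. ?E k)"
    by (rule LIMSEQ_le_const[OF limE]) (use lower in auto)
  ultimately show "measure ?M (st -` C \<inter> elems (star_sets Y N)) = measure \<nu> C"
    unfolding eq by simp
qed

text \<open>
  The closed sets generate the Borel sets and are closed under intersection, so two finite measures
  agreeing on them are equal.
\<close>

lemma st_measure_preserving:
  assumes comp: "compact (UNIV :: 'a set)" and N: "infinite_hypernat N"
    and Y: "weakly_approximated \<nu> Y"
  shows "measure_preserving (loeb (star_sets Y N)) \<nu> st"
proof -
  interpret weakly_approximated \<nu> Y by fact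
  interpret hyperfinite std ext "star_sets Y N" by (rule hyperfinite_star_sets[OF N fin ne])
  let ?M = "loeb (star_sets Y N)"
  interpret M: prob_space ?M by (rule prob_space_loeb)
  have closed: "st -` C \<inter> space ?M \<in> sets ?M \<and> emeasure ?M (st -` C \<inter> space ?M) = emeasure \<nu> C"
    if "closed C" for C
  proof (cases "C = {}")
    case False
    then show ?thesis using loeb_st_closed[OF comp N Y that False]
      by (simp add: M.emeasure_eq_measure emeasure_eq_measure)
  qed simp
  have meas: "st \<in> measurable ?M borel"
    unfolding borel_eq_closed by (rule measurable_measure_of) (use closed in auto)
  have "distr ?M borel st = \<nu>"
  proof (rule measure_eqI_generator_eq[where E = "Collect closed" and \<Omega> = UNIV and A = "\<lambda>_. UNIV"])
    show "Int_stable (Collect closed)" by (auto simp: Int_stable_def)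
    show "emeasure (distr ?M borel st) X = emeasure \<nu> X" if "X \<in> Collect closed" for X
      using that closed meas by (simp add: emeasure_distr)
    have "sets borel = sigma_sets UNIV (Collect (closed :: 'a set \<Rightarrow> bool))"
      by (subst borel_eq_closed) simp
    then show "sets (distr ?M borel st) = sigma_sets UNIV (Collect closed)"
      "sets \<nu> = sigma_sets UNIV (Collect closed)"
      by (simp_all add: sets_eq)
    show "emeasure (distr ?M borel st) UNIV \<noteq> \<infinity>" for i :: nat
      using M.emeasure_finite meas by (simp add: emeasure_distr)
  qed auto
  moreover have "st \<in> measurable ?M \<nu>"
    using meas measurable_cong_sets[OF refl sets_eq] by blast
  ultimately show ?thesis unfolding measure_preserving_def
    using emeasure_distr[OF meas] sets_eq by metis
qed

section \<open>Hyperfinite approximation\<close>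

text \<open>
  Off the exceptional sets \<open>T\<^sub>N y\<close> is infinitely close to \<open>*\<tau> y\<close>, and \<open>*\<tau> y\<close> is infinitely close to
  \<open>\<tau> (st y)\<close> by continuity of \<open>\<tau>\<close> at \<open>st y\<close>.
\<close>

lemma near_star_apply:
  assumes comp: "compact (UNIV :: 'a set)" and N: "infinite_hypernat N"
    and y: "y \<in> elems (star_sets Y N)"
    and cont: "isCont \<tau> (st y)"
    and good: "\<And>k::nat. y \<notin> elems (star_sets (\<lambda>n. {y \<in> Y n. dist (T n y) (\<tau> y) \<ge> 1 / Suc k}) N)"
  shows "near (star_apply (star_maps T N) y) (std (Point (\<tau> (st y))))"
  unfolding near_std_iff
proof (intro allI impI)
  fix \<epsilon> :: real assume "\<epsilon> > 0"
  let ?app = "\<lambda>xs. case xs of [Selfmap f, Point x] \<Rightarrow> Point (f x)"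
  let ?maps = "\<lambda>xs. case xs of [Natural n] \<Rightarrow> Selfmap (T n)"
  let ?F = "star_maps T N"
  let ?z = "star_apply ?F y"
  \<comment> \<open>The type of the value \<open>?z\<close> is computed from that of \<open>(y, N)\<close> in three steps.\<close>
  have 1: "tp [?F, y, N] = filtermap (\<lambda>xs. ?maps [xs ! 1] # xs) (tp [y, N])"
    using tp_star_fun_reindex[of "[1]" "[y, N]" ?maps] by (simp add: star_maps_def)
  have 2: "tp [?z, ?F, y, N] = filtermap (\<lambda>xs. ?app [xs ! 0, xs ! 1] # xs) (tp [?F, y, N])"
    using tp_star_fun_reindex[of "[0, 1]" "[?F, y, N]" ?app] by (simp add: star_apply_def)
  have 3: "tp [?z] = filtermap (\<lambda>xs. [xs ! 0]) (tp [?z, ?F, y, N])"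
    using tp_reindex[of "[0]" "[?z, ?F, y, N]"] by simp
  obtain d where d: "d > 0" "\<And>x. dist x (st y) < d \<Longrightarrow> dist (\<tau> x) (\<tau> (st y)) < \<epsilon> / 2"
    using cont \<open>\<epsilon> > 0\<close> unfolding continuous_at_eps_delta by (metis half_gt_zero)
  obtain k :: nat where k: "1 / Suc k < \<epsilon> / 2"
    using \<open>\<epsilon> > 0\<close> by (metis half_gt_zero nat_approx_posE)
  have "eventually (\<lambda>xs. \<exists>a. xs = [Point a] \<and> dist a (st y) < d) (tp [y])"
    using near_st[OF comp elems_Point[OF y]] d(1) unfolding near_std_iff by simp
  then have "eventually (\<lambda>xs. \<exists>a. [xs ! 0] = [Point a] \<and> dist a (st y) < d) (tp [y, N])"
    using tp_reindex[of "[0]" "[y, N]"] by (simp add: eventually_filtermap)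
  moreover have "eventually (\<lambda>xs. \<exists>a n. xs = [Point a, Natural n] \<and> a \<in> Y n) (tp [y, N])"
    using y by (simp add: elems_star_sets[OF N])
  moreover have "eventually (\<lambda>xs. \<not> (\<exists>a n. xs = [Point a, Natural n] \<and>
      a \<in> {y \<in> Y n. dist (T n y) (\<tau> y) \<ge> 1 / Suc k})) (tp [y, N])"
    using good[of k] unfolding elems_star_sets[OF N] tp_Not .
  ultimately have "eventually (\<lambda>xs. \<exists>a. [?app [?maps [xs ! 1], xs ! 0]] = [Point a] \<and> dist a (\<tau> (st y)) < \<epsilon>) (tp [y, N])"
  proof eventually_elim
    case (elim xs)
    then obtain a n where xs: "xs = [Point a, Natural n]" and a: "a \<in> Y n" "dist a (st y) < d" by auto
    have "dist (T n a) (\<tau> a) < 1 / Suc k" using elim(3) xs a(1) by auto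
    moreover have "dist (\<tau> a) (\<tau> (st y)) < \<epsilon> / 2" by (rule d(2)[OF a(2)])
    ultimately have "dist (T n a) (\<tau> (st y)) < \<epsilon>"
      using dist_triangle[of "T n a" "\<tau> (st y)" "\<tau> a"] k by simp
    then show ?case by (simp add: xs)
  qed
  then show "eventually (\<lambda>xs. \<exists>a. xs = [Point a] \<and> dist a (\<tau> (st y)) < \<epsilon>) (tp [?z])"
    unfolding 3 2 1 eventually_filtermap by simp
qed

text \<open>
  The exceptional sets of the preceding lemma are internal with infinitesimal relative size, hence
  Loeb null sets, and there are countably many of them. The points whose standard part is a
  discontinuity of \<open>\<tau>\<close> form a null set because \<open>st\<close> preserves measure.
\<close>

lemma hyperfinite_approximation_of_finite:
  assumes comp: "compact (UNIV :: 'a set)" and N: "infinite_hypernat N"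
    and Y: "weakly_approximated \<nu> Y"
    and cont: "AE x in \<nu>. isCont \<tau> x"
    and T: "\<And>e. e > 0 \<Longrightarrow> (\<lambda>n. real (card {y \<in> Y n. dist (T n y) (\<tau> y) \<ge> e}) / real (card (Y n))) \<longlonglongrightarrow> 0"
  shows "hyperfinite_approximation (star_sets Y N) (star_maps T N) \<nu> \<tau>"
proof -
  interpret weakly_approximated \<nu> Y by fact
  interpret hyperfinite std ext "star_sets Y N" by (rule hyperfinite_star_sets[OF N fin ne])
  let ?M = "loeb (star_sets Y N)"
  interpret M: prob_space ?M by (rule prob_space_loeb)
  have mp: "measure_preserving ?M \<nu> st" by (rule st_measure_preserving[OF comp N Y])
  have "AE y in ?M. isCont \<tau> (st y)"
  proof -
    obtain Z where Z: "{x \<in> space \<nu>. \<not> isCont \<tau> x} \<subseteq> Z" "emeasure \<nu> Z = 0" "Z \<in> sets \<nu>"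
      using cont by (rule AE_E)
    have "st -` Z \<inter> space ?M \<in> null_sets ?M"
      using mp Z(2,3) unfolding measure_preserving_def by (intro null_setsI measurable_sets[of st ?M \<nu>]) auto
    then show ?thesis by (rule AE_I') (use Z(1) space_eq in auto)
  qed
  moreover have "AE y in ?M. \<forall>k::nat. y \<notin> elems (star_sets (\<lambda>n. {y \<in> Y n. dist (T n y) (\<tau> y) \<ge> 1 / Suc k}) N)"
    unfolding AE_all_countable
  proof
    fix k :: nat
    let ?S = "\<lambda>n. {y \<in> Y n. dist (T n y) (\<tau> y) \<ge> 1 / Suc k}"
    have "measure ?M (elems (star_sets ?S N)) \<le> c" if "0 < c" for c
      by (rule measure_loeb_star_sets_le[OF N fin ne])
         (use order_tendstoD(2)[OF T[of "1 / Suc k"] that] in \<open>auto elim: eventually_mono\<close>)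
    then have "measure ?M (elems (star_sets ?S N)) = 0"
      using dense_ge[of 0] by (intro antisym) auto
    moreover have "elems (star_sets ?S N) \<in> sets ?M"
      by (rule elems_in_loeb, rule star_sets_internal[OF N]) auto
    ultimately have "elems (star_sets ?S N) \<in> null_sets ?M"
      by (simp add: null_sets_def M.emeasure_eq_measure)
    then show "AE y in ?M. y \<notin> elems (star_sets ?S N)" by (rule AE_not_in)
  qed
  ultimately have "AE y in ?M. near (star_apply (star_maps T N) y) (std (Point (\<tau> (st y))))"
    using AE_space by eventually_elim (auto intro: near_star_apply[OF comp N])
  with mp show ?thesis by (simp add: hyperfinite_approximation_def)
qed

end

theorem theorem10:
  fixes std :: "'a::metric_space entity \<Rightarrow> 't"
    and ext :: "('a entity list \<Rightarrow> bool) \<Rightarrow> 't list \<Rightarrow> bool"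
    and \<nu> :: "'a measure"
    and \<tau> :: "'a \<Rightarrow> 'a"
  assumes universe: "nonstandard_universe std ext"
    and compact: "compact (UNIV :: 'a set)"
    and borel: "sets \<nu> = sets borel"
    and prob: "prob_space \<nu>"
    and non_atomic: "non_atomic \<nu>"
    and balls: "\<And>x r. 0 < r \<Longrightarrow> 0 < emeasure \<nu> (ball x r)"
    and preserving: "measure_preserving \<nu> \<nu> \<tau>"
    and continuity: "emeasure \<nu> {x. isCont \<tau> x} = 1"
  shows "(\<exists>(Y :: nat \<Rightarrow> 'a set) (T :: nat \<Rightarrow> 'a \<Rightarrow> 'a).
            (\<forall>n. finite (Y n) \<and> Y n \<noteq> {} \<and> T n permutes Y n) \<and>
            nonstandard_universe.approximates_system std ext Y T \<nu> \<tau>) \<and>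
         (\<exists>(Y :: nat \<Rightarrow> 'a set) (T :: nat \<Rightarrow> 'a \<Rightarrow> 'a).
            (\<forall>n. finite (Y n) \<and> Y n \<noteq> {} \<and> T n permutes Y n \<and> transitive_perm (T n) (Y n)) \<and>
            nonstandard_universe.approximates_system std ext Y T \<nu> \<tau>)"
proof -
  interpret nonstandard_universe std ext by (rule universe)
  interpret prob: prob_space \<nu> by (rule prob)
  obtain cs :: "nat \<Rightarrow> 'a list" where cs: "\<And>n. distinct (cs n)" "\<And>n. cs n \<noteq> []"
    and weak: "approximates_space (\<lambda>n. set (cs n)) \<nu>"
    and shadow: "\<And>e. 0 < e \<Longrightarrow> (\<lambda>n. real (card {y\<in>set (cs n). e \<le> dist (cycle_of_list (cs n) y) (\<tau> y)})
      / card (set (cs n))) \<longlonglongrightarrow> 0"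
    by (rule finite_approximation_sequence[OF compact prob borel non_atomic preserving]) blast
  define Y where "Y n = set (cs n)" for n
  define T where "T n = cycle_of_list (cs n)" for n
  have Y: "weakly_approximated \<nu> Y"
  proof (intro weakly_approximated.intro weakly_approximated_axioms.intro prob borel)
    show "finite (Y n)" "Y n \<noteq> {}" for n using cs(2) by (simp_all add: Y_def)
    show "approximates_space Y \<nu>" using weak by (simp add: Y_def[abs_def])
  qed
  have "AE x in \<nu>. x \<in> {x. isCont \<tau> x}"
    using continuity by (intro prob.AE_prob_1) (simp add: measure_def)
  then have cont: "AE x in \<nu>. isCont \<tau> x" by simp
  have "hyperfinite_approximation (star_sets Y N) (star_maps T N) \<nu> \<tau>" if "infinite_hypernat N" for N
    by (rule hyperfinite_approximation_of_finite[OF compact that Y cont])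
       (use shadow in \<open>simp add: Y_def T_def\<close>)
  moreover have "approximates_space Y \<nu>" using weak by (simp add: Y_def[abs_def])
  ultimately have "approximates_system Y T \<nu> \<tau>" by (simp add: approximates_system_def)
  moreover have "finite (Y n) \<and> Y n \<noteq> {} \<and> T n permutes Y n \<and> transitive_perm (T n) (Y n)" for n
    using cs[of n] cycle_permutes[of "cs n"] by (auto simp: Y_def T_def transitive_perm_def)
  ultimately show ?thesis by blast
qed

end
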